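(* Let $X$ be a locally compact Hausdorff space, $\mathcal{A}$ a unital $C^*$-algebra, and $\mathcal{E}$ a $*$-subalgebra of $C_0(X,\mathcal{A})$ such that: (AX0) if $X$ is noncompact, then for each $z\in X$ either $f_0(z)$ is invertible in $\mathcal{A}$ for some $f_0\in\mathcal{E}$, or $f(z)=0$ for all $f\in\mathcal{E}$; and for any two points $x,y\in X$ one of the following holds: (AX1) $x$ and $y$ are spectrally separated by $\mathcal{E}$; or (AX2) $M(f(x))=M(f(y))$ for every selfadjoint $f\in\mathcal{E}$. Then the uniform closure of $\mathcal{E}$ in $C_0(X,\mathcal{A})$ coincides with the $*$-algebra $\Delta_2(\mathcal{E})$ of all $u\in C_0(X,\mathcal{A})$ such that for any $x,y\in X$ and each $\varepsilon>0$ there is $v\in\mathcal{E}$ with $\|v(z)-u(z)\|<\varepsilon$ for $z\in\{x,y\}$.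
   Context: $C_0(X,\mathcal{A})$ denotes the $C^*$-algebra (pointwise operations, supremum norm) of continuous $f\colon X\to\mathcal{A}$ vanishing at infinity (for every $\varepsilon>0$ there is a compact $K$ with $\|f(x)\|<\varepsilon$ off $K$). For a selfadjoint $a\in\mathcal{A}$, $M(a)=\max\sigma(a)$. A collection $\mathcal{F}$ of functions $X\to\mathcal{A}$ spectrally separates distinct points $x,y$ if there is $f\in\mathcal{F}$ such that $f(x),f(y)$ are normal and $\sigma(f(x))\cap\sigma(f(y))=\emptyset$. *)

theory Defs
  imports "HOL-Analysis.Analysis"
begin

class complex_banach_algebra_1 = real_normed_algebra_1 + banach +
  fixes scaleC :: "complex \<Rightarrow> 'a \<Rightarrow> 'a" (infixr \<open>*\<^sub>C\<close> 75)
  assumes scaleC_add_right: "c *\<^sub>C (x + y) = c *\<^sub>C x + c *\<^sub>C y"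
    and scaleC_add_left: "(c + d) *\<^sub>C x = c *\<^sub>C x + d *\<^sub>C x"
    and scaleC_scaleC: "c *\<^sub>C (d *\<^sub>C x) = (c * d) *\<^sub>C x"
    and scaleC_one: "1 *\<^sub>C x = x"
    and scaleR_scaleC: "r *\<^sub>R x = complex_of_real r *\<^sub>C x"
    and norm_scaleC: "norm (c *\<^sub>C x) = cmod c * norm x"
    and mult_scaleC_left: "(c *\<^sub>C x) * y = c *\<^sub>C (x * y)"
    and mult_scaleC_right: "x * (c *\<^sub>C y) = c *\<^sub>C (x * y)"

definition cstar_involution :: "('a::complex_banach_algebra_1 \<Rightarrow> 'a) \<Rightarrow> bool" where
  "cstar_involution st \<longleftrightarrow>
     (\<forall>a b. st (a + b) = st a + st b) \<and>
     (\<forall>(c::complex) a. st (c *\<^sub>C a) = cnj c *\<^sub>C st a) \<and>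
     (\<forall>a b. st (a * b) = st b * st a) \<and>
     (\<forall>a. st (st a) = a) \<and>
     (\<forall>a. norm (st a * a) = norm a ^ 2)"

definition invertible_el :: "'a::ring_1 \<Rightarrow> bool" where
  "invertible_el a \<longleftrightarrow> (\<exists>b. a * b = 1 \<and> b * a = 1)"

definition spec :: "'a::complex_banach_algebra_1 \<Rightarrow> complex set" where
  "spec a = {l. \<not> invertible_el (a - l *\<^sub>C 1)}"

definition normal_el :: "('a \<Rightarrow> 'a) \<Rightarrow> 'a::complex_banach_algebra_1 \<Rightarrow> bool" where
  "normal_el st a \<longleftrightarrow> st a * a = a * st a"

text \<open>M(a) = max of the (real) spec of a selfadjoint element.\<close>
definition Mspec :: "'a::complex_banach_algebra_1 \<Rightarrow> real" where
  "Mspec a = Sup (Re ` spec a)"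

definition C0 :: "('x::topological_space \<Rightarrow> 'a::real_normed_vector) set" where
  "C0 = {f. continuous_on UNIV f \<and>
            (\<forall>\<epsilon>>0. \<exists>K. compact K \<and> (\<forall>x. x \<notin> K \<longrightarrow> norm (f x) < \<epsilon>))}"

definition star_subalgebra ::
  "('a \<Rightarrow> 'a) \<Rightarrow> ('x::topological_space \<Rightarrow> 'a::complex_banach_algebra_1) set \<Rightarrow> bool" where
  "star_subalgebra st E \<longleftrightarrow> E \<subseteq> C0 \<and> (\<lambda>_. 0) \<in> E \<and>
     (\<forall>f\<in>E. \<forall>g\<in>E. (\<lambda>x. f x + g x) \<in> E \<and> (\<lambda>x. f x * g x) \<in> E) \<and>
     (\<forall>f\<in>E. \<forall>c::complex. (\<lambda>x. c *\<^sub>C f x) \<in> E) \<and>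
     (\<forall>f\<in>E. (\<lambda>x. st (f x)) \<in> E)"

definition spectrally_separates ::
  "('a \<Rightarrow> 'a) \<Rightarrow> ('x \<Rightarrow> 'a::complex_banach_algebra_1) set \<Rightarrow> 'x \<Rightarrow> 'x \<Rightarrow> bool" where
  "spectrally_separates st F x y \<longleftrightarrow>
     (\<exists>f\<in>F. normal_el st (f x) \<and> normal_el st (f y) \<and> spec (f x) \<inter> spec (f y) = {})"

definition uniform_closure :: "('x::topological_space \<Rightarrow> 'a::real_normed_vector) set \<Rightarrow> ('x \<Rightarrow> 'a) set" where
  "uniform_closure E = {u \<in> C0. \<forall>\<epsilon>>0. \<exists>v\<in>E. (SUP x. norm (v x - u x)) < \<epsilon>}"

definition Delta2 :: "('x::topological_space \<Rightarrow> 'a::real_normed_vector) set \<Rightarrow> ('x \<Rightarrow> 'a) set" where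
  "Delta2 E = {u \<in> C0. \<forall>x y. \<forall>\<epsilon>>0. \<exists>v\<in>E. norm (v x - u x) < \<epsilon> \<and> norm (v y - u y) < \<epsilon>}"

end

theory Submission
  imports Defs
begin

text \<open>The elements of \<open>E\<close> need not commute, so there are no characters to work with; what
  replaces them is the continuous functional calculus \<open>cfc f a\<close> of a selfadjoint \<open>a\<close>. Its norm
  estimate is elementary: if \<open>norm a < 1\<close>, then \<open>a\<close> is the average of a unitary \<open>u\<close> and its inverse,
  so a polynomial of degree \<open>d\<close> in \<open>a\<close> is, up to a power of \<open>u\<close>, a polynomial of degree \<open>2 d\<close> in \<open>u\<close>
  whose coefficients are at most the maximum \<open>M\<close> of the former on \<open>[-1, 1]\<close>. This gives the bound
  \<open>(2 d + 1) M\<close>, which improves to \<open>M\<close> by passing to powers.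

  Let \<open>E\<close> be uniformly closed, and call \<open>x\<close> and \<open>y\<close> norm-equivalent if \<open>f x + c\<close> and \<open>f y + c\<close>
  always have the same norm, as (AX2) implies. If \<open>f x\<close> and \<open>f y\<close> are normal with disjoint spectra,
  evaluate a partition of unity of the plane into small cells at their real and imaginary parts:
  each cell vanishes on \<open>f x\<close> or on \<open>f y\<close>, so the cells vanishing on \<open>f y\<close> add up to \<open>1\<close> at \<open>x\<close> and
  to \<open>0\<close> at \<open>y\<close>. The result is a multiplier of \<open>E\<close>. If \<open>x\<close> is nondegenerate, that is if some \<open>f x\<close> is
  invertible, then \<open>h x = 1\<close> for some \<open>h\<close> in \<open>E\<close>, and the product separates \<open>x\<close> from \<open>y\<close>. By
  compactness and layered averages, \<open>E\<close> contains the scalar functions vanishing at infinity and at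
  all degenerate points that are constant on norm-equivalence classes. Scalars are central, so these
  functions glue local approximations of an element of \<open>Delta2 E\<close>. The degenerate points are all
  norm-equivalent, so a single element of \<open>E\<close> takes care of them.\<close>

section \<open>Real polynomials in algebras\<close>

definition poly_alg :: "real poly \<Rightarrow> 'a::real_algebra_1 \<Rightarrow> 'a" where
  "poly_alg p a = fold_coeffs (\<lambda>c b. c *\<^sub>R 1 + a * b) p 0"

lemma poly_alg_0 [simp]: "poly_alg 0 a = 0"
  by (simp add: poly_alg_def)

lemma poly_alg_pCons [simp]: "poly_alg (pCons c p) a = c *\<^sub>R 1 + a * poly_alg p a"
  by (cases "p = 0 \<and> c = 0") (auto simp: poly_alg_def)

lemma poly_alg_1 [simp]: "poly_alg 1 a = 1"
  by (simp add: one_pCons)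

lemma poly_alg_add: "poly_alg (p + q) a = poly_alg p a + poly_alg q a"
  by (induction p q rule: poly_induct2) (auto simp: algebra_simps)

lemma poly_alg_diff: "poly_alg (p - q) a = poly_alg p a - poly_alg q a"
  using poly_alg_add[of "p - q" q a] by simp

lemma poly_alg_smult: "poly_alg (smult c p) a = c *\<^sub>R poly_alg p a"
  by (induction p) (auto simp: algebra_simps)

lemma poly_alg_mult: "poly_alg (p * q) a = poly_alg p a * poly_alg q a"
  by (induction p) (auto simp: poly_alg_add poly_alg_smult algebra_simps)

lemma poly_alg_power: "poly_alg (p ^ n) a = poly_alg p a ^ n"
  by (induction n) (auto simp: poly_alg_mult)

lemma poly_alg_sum: "poly_alg (\<Sum>i\<in>I. p i) a = (\<Sum>i\<in>I. poly_alg (p i) a)"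
  by (induction I rule: infinite_finite_induct) (auto simp: poly_alg_add)

lemma poly_alg_monom: "poly_alg (monom c n) a = c *\<^sub>R a ^ n"
  by (induction n) (auto simp: monom_0 monom_Suc)

lemma poly_alg_altdef: "poly_alg p a = (\<Sum>i\<le>degree p. coeff p i *\<^sub>R a ^ i)"
  by (subst poly_as_sum_of_monoms[of p, symmetric]) (simp only: poly_alg_sum poly_alg_monom)

lemma poly_alg_pcompose: "poly_alg (pcompose p q) a = poly_alg p (poly_alg q a)"
  by (induction p) (auto simp: pcompose_pCons poly_alg_add poly_alg_mult)

lemma poly_alg_scaleR_1: "poly_alg p (c *\<^sub>R 1) = poly p c *\<^sub>R 1"
  by (induction p) (auto simp: algebra_simps)

lemma poly_alg_commute:
  assumes "b * a = a * b" shows "b * poly_alg p a = poly_alg p a * b"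
proof (induction p)
  case (pCons c p)
  have "b * (a * poly_alg p a) = a * (b * poly_alg p a)"
    by (simp add: assms flip: mult.assoc)
  then show ?case by (simp add: pCons.IH distrib_left distrib_right mult.assoc)
qed simp

lemma tendsto_poly_alg:
  fixes g :: "'b \<Rightarrow> 'a::real_normed_algebra_1"
  assumes "(g \<longlongrightarrow> a) F" shows "((\<lambda>x. poly_alg p (g x)) \<longlongrightarrow> poly_alg p a) F"
  unfolding poly_alg_altdef by (intro tendsto_intros assms)

lemma poly_map_poly_of_real: "poly (map_poly of_real p) z = poly_alg p (z::complex)"
  by (induction p) (auto simp: map_poly_pCons scaleR_conv_of_real)

lemma le_if_dyadic_powers_le:
  fixes x y :: real
  assumes "0 \<le> y" and bound: "\<And>n. x ^ (2 ^ n) \<le> (c * 2 ^ n + 1) * y ^ (2 ^ n)"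
  shows "x \<le> y"
proof (rule ccontr)
  assume "\<not> ?thesis"
  then have x: "x > y" "x > 0" using assms(1) by auto
  define r where "r = y / x"
  have r: "0 \<le> r" "r < 1" using x assms(1) by (auto simp: r_def)
  have subseq: "strict_mono (\<lambda>n. 2 ^ n :: nat)" by (simp add: strict_mono_def)
  have "(\<lambda>n. c * (real n * r ^ n) + r ^ n) \<longlonglongrightarrow> c * 0 + 0"
    using r by (intro tendsto_intros powser_times_n_limit_0 LIMSEQ_realpow_zero) auto
  from LIMSEQ_subseq_LIMSEQ[OF this subseq]
  have "(\<lambda>n. c * (2 ^ n * r ^ (2 ^ n)) + r ^ (2 ^ n)) \<longlonglongrightarrow> 0" by (simp add: o_def)
  moreover have "1 \<le> c * (2 ^ n * r ^ (2 ^ n)) + r ^ (2 ^ n)" for n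
    using bound[of n] x by (simp add: r_def power_divide field_simps)
  ultimately have "(1::real) \<le> 0" by (intro tendsto_lowerbound) auto
  then show False by simp
qed

lemma sum_power_roots_unity:
  assumes "n > 0"
  shows "(\<Sum>z | z ^ n = 1. z ^ m) = (if n dvd m then of_nat n else (0::complex))"
proof (cases "n dvd m")
  case True
  then obtain k where k: "m = n * k" by blast
  have "(\<Sum>z | z ^ n = 1. z ^ m) = (\<Sum>z::complex | z ^ n = 1. 1::complex)"
    by (rule sum.cong) (auto simp: k power_mult)
  then show ?thesis using True assms by (simp add: card_roots_unity_eq)
next
  case False
  define \<omega> :: complex where "\<omega> = exp (2 * of_real pi * \<i> / of_nat n)"
  have \<omega>_power: "\<omega> ^ j = exp (2 * of_real pi * \<i> * of_nat j / of_nat n)" for j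
    by (simp add: \<omega>_def mult_ac flip: exp_of_nat_mult)
  have \<omega>: "\<omega> ^ n = 1" "\<omega> ^ m \<noteq> 1"
    using assms False complex_root_unity_eq_1[of n n] complex_root_unity_eq_1[of n m]
    by (simp_all only: \<omega>_power) auto
  have "\<omega> \<noteq> 0" by (simp add: \<omega>_def)
  have "(\<Sum>z | z ^ n = 1. z ^ m) = (\<Sum>z | z ^ n = 1. (\<omega> * z) ^ m)"
    by (rule sum.reindex_bij_witness[of _ "\<lambda>z. \<omega> * z" "\<lambda>z. z / \<omega>"])
      (use \<omega> \<open>\<omega> \<noteq> 0\<close> in \<open>auto simp: power_mult_distrib power_divide\<close>)
  also have "\<dots> = \<omega> ^ m * (\<Sum>z | z ^ n = 1. z ^ m)"
    by (simp add: power_mult_distrib sum_distrib_left)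
  finally show ?thesis using \<omega>(2) False by simp
qed

lemma norm_coeff_le_circle_bound:
  fixes p :: "complex poly"
  assumes bound: "\<And>z. cmod z = 1 \<Longrightarrow> cmod (poly p z) \<le> M"
  shows "cmod (coeff p k) \<le> M"
proof (cases "k \<le> degree p")
  case False
  then show ?thesis using order_trans[OF norm_ge_zero bound[of 1]] by (simp add: coeff_eq_0)
next
  case True
  define n where "n = Suc (degree p)"
  have n: "n > 0" "k < n" using True by (auto simp: n_def)
  have dvd_iff: "n dvd i + (n - k) \<longleftrightarrow> i = k" if "i \<le> degree p" for i
  proof
    assume "n dvd i + (n - k)"
    then obtain l where l: "i + (n - k) = n * l" ..
    have "0 < n * l" "n * l < n * 2" unfolding l[symmetric] using that n by (auto simp: n_def)
    then have "l = 1" by simp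
    then show "i = k" using l n by simp
  qed (use n in simp)
  have "(\<Sum>z | z ^ n = 1. poly p z * z ^ (n - k))
      = (\<Sum>i\<le>degree p. coeff p i * (\<Sum>z | z ^ n = 1. z ^ (i + (n - k))))"
    by (simp add: poly_altdef sum_distrib_left sum_distrib_right power_add mult_ac
        sum.swap[of _ "{..degree p}"])
  also have "\<dots> = (\<Sum>i\<le>degree p. if i = k then coeff p k * of_nat n else 0)"
    by (intro sum.cong) (auto simp: sum_power_roots_unity[OF n(1)] dvd_iff)
  also have "\<dots> = coeff p k * of_nat n" using True by simp
  finally have "cmod (coeff p k) * real n = cmod (\<Sum>z | z ^ n = 1. poly p z * z ^ (n - k))"
    by (simp add: norm_mult)
  also have "\<dots> \<le> (\<Sum>z::complex | z ^ n = 1. M)"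
    using bound n(1) by (intro sum_norm_le) (auto simp: norm_mult norm_power dest: power_eq_1_iff)
  also have "\<dots> = M * real n" using n(1) by (simp add: card_roots_unity_eq)
  finally show ?thesis using n(1) by simp
qed

definition joukowski_lift :: "real poly \<Rightarrow> real poly" where
  "joukowski_lift p =
     (\<Sum>i\<le>degree p. smult (coeff p i) (monom 1 (degree p - i) * [:1/2, 0, 1/2:] ^ i))"

lemma degree_joukowski_lift_le: "degree (joukowski_lift p) \<le> 2 * degree p"
  unfolding joukowski_lift_def
proof (rule degree_sum_le)
  fix i assume i: "i \<in> {..degree p}"
  have "degree (smult (coeff p i) (monom 1 (degree p - i) * [:1/2, 0, 1/2:] ^ i))
      \<le> degree (monom (1::real) (degree p - i)) + degree ([:1/2, 0, 1/2::real:] ^ i)"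
    by (intro order_trans[OF degree_smult_le degree_mult_le])
  also have "\<dots> \<le> (degree p - i) + 2 * i"
    by (intro add_mono degree_monom_le order_trans[OF degree_power_le]) simp
  finally show "degree (smult (coeff p i) (monom 1 (degree p - i) * [:1/2, 0, 1/2:] ^ i))
      \<le> 2 * degree p"
    using i by simp
qed simp

lemma poly_alg_joukowski_lift:
  fixes u v :: "'a::real_algebra_1"
  assumes "u * v = 1" "v * u = 1"
  shows "poly_alg (joukowski_lift p) u = u ^ degree p * poly_alg p ((1/2) *\<^sub>R (u + v))"
proof -
  define a where "a = (1/2) *\<^sub>R (u + v)"
  have quadratic: "poly_alg [:1/2, 0, 1/2:] u = u * a" and commute: "u * a = a * u"
    using assms by (auto simp: a_def algebra_simps)
  have ua: "(u * a) ^ i = u ^ i * a ^ i" for i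
  proof (induction i)
    case (Suc i)
    have "u * a * (u ^ i * a ^ i) = u * (a * u ^ i) * a ^ i" by (simp add: mult.assoc)
    also have "a * u ^ i = u ^ i * a" using power_commuting_commutes[OF commute] by simp
    finally show ?case by (simp add: Suc mult.assoc)
  qed simp
  have "u ^ (degree p - i) * (u ^ i * a ^ i) = u ^ degree p * a ^ i" if "i \<le> degree p" for i
    using that by (simp add: mult.assoc[symmetric] power_add[symmetric])
  then show ?thesis
    unfolding joukowski_lift_def a_def[symmetric] poly_alg_altdef[of p]
    by (simp add: poly_alg_sum poly_alg_smult poly_alg_mult poly_alg_monom poly_alg_power quadratic ua
        sum_distrib_left del: poly_alg_pCons)
qed

lemma coeff_joukowski_lift_le:
  assumes M: "\<And>t. \<bar>t\<bar> \<le> 1 \<Longrightarrow> \<bar>poly p t\<bar> \<le> M"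
  shows "\<bar>coeff (joukowski_lift p) k\<bar> \<le> M"
proof -
  have "cmod (poly (map_poly of_real (joukowski_lift p)) z) \<le> M" if z: "cmod z = 1" for z
  proof -
    have "z * cnj z = 1" using z by (simp add: complex_norm_square[symmetric])
    then have "poly_alg (joukowski_lift p) z = z ^ degree p * poly_alg p ((1/2) *\<^sub>R (z + cnj z))"
      by (intro poly_alg_joukowski_lift) (auto simp: mult.commute)
    also have "(1/2) *\<^sub>R (z + cnj z) = Re z *\<^sub>R 1" by (simp add: complex_eq_iff)
    finally have "cmod (poly_alg (joukowski_lift p) z) = \<bar>poly p (Re z)\<bar>"
      by (simp add: poly_alg_scaleR_1 norm_mult norm_power z)
    moreover have "\<bar>Re z\<bar> \<le> 1" using abs_Re_le_cmod[of z] z by simp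
    ultimately show ?thesis using M by (simp add: poly_map_poly_of_real)
  qed
  from norm_coeff_le_circle_bound[OF this, of k] show ?thesis by (simp add: coeff_map_poly)
qed

lemma norm_poly_alg_le_coeff_bound:
  fixes u :: "'a::real_normed_algebra_1"
  assumes "\<And>k. \<bar>coeff p k\<bar> \<le> M" "norm u \<le> 1"
  shows "norm (poly_alg p u) \<le> (real (degree p) + 1) * M"
proof -
  have "norm (poly_alg p u) \<le> (\<Sum>k\<le>degree p. M)"
    unfolding poly_alg_altdef
  proof (rule sum_norm_le)
    fix k
    have "norm (u ^ k) \<le> 1"
      using norm_power_ineq[of u k] power_le_one[OF norm_ge_zero assms(2), of k] by simp
    then have "norm (coeff p k *\<^sub>R u ^ k) \<le> \<bar>coeff p k\<bar>" by (simp add: mult_left_le)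
    then show "norm (coeff p k *\<^sub>R u ^ k) \<le> M" using assms(1)[of k] by simp
  qed
  then show ?thesis by (simp add: algebra_simps)
qed

section \<open>Polynomials in a selfadjoint element\<close>

interpretation scaleC: bounded_bilinear
  "scaleC :: complex \<Rightarrow> 'a \<Rightarrow> 'a::complex_banach_algebra_1"
proof
  fix c d :: complex and x y :: 'a and r :: real
  show "(c + d) *\<^sub>C x = c *\<^sub>C x + d *\<^sub>C x" by (rule scaleC_add_left)
  show "c *\<^sub>C (x + y) = c *\<^sub>C x + c *\<^sub>C y" by (rule scaleC_add_right)
  show "(r *\<^sub>R c) *\<^sub>C x = r *\<^sub>R (c *\<^sub>C x)"
    by (simp add: scaleR_scaleC scaleC_scaleC scaleR_conv_of_real)
  show "c *\<^sub>C (r *\<^sub>R x) = r *\<^sub>R (c *\<^sub>C x)"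
    by (simp add: scaleR_scaleC scaleC_scaleC mult.commute)
  show "\<exists>K. \<forall>(c::complex) (x::'a). norm (c *\<^sub>C x) \<le> norm c * norm x * K"
    by (rule exI[of _ 1]) (simp add: norm_scaleC)
qed

lemma scaleC_minus_one: "(-1) *\<^sub>C (x::'a::complex_banach_algebra_1) = - x"
  by (simp add: scaleC.minus_left scaleC_one)

lemma norm_half_add_square_le:
  fixes a y :: "'a::real_normed_algebra"
  assumes "norm a \<le> r" "norm y \<le> r"
  shows "norm ((1/2) *\<^sub>R (a * a + y * y)) \<le> r * r"
proof -
  have "norm (z * z) \<le> r * r" if "norm z \<le> r" for z :: 'a
    using norm_mult_ineq[of z z] mult_mono'[OF that that] by simp
  from this[OF assms(1)] this[OF assms(2)] show ?thesis
    using norm_triangle_ineq[of "a * a" "y * y"] by simp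
qed

lemma dist_half_add_square_le:
  fixes c y z :: "'a::real_normed_algebra"
  assumes "norm y \<le> r" "norm z \<le> r"
  shows "dist ((1/2) *\<^sub>R (c + y * y)) ((1/2) *\<^sub>R (c + z * z)) \<le> r * dist y z"
proof -
  have "(1/2) *\<^sub>R (c + y * y) - (1/2) *\<^sub>R (c + z * z) = (1/2) *\<^sub>R (y * (y - z) + (y - z) * z)"
    by (simp add: algebra_simps)
  then have "dist ((1/2) *\<^sub>R (c + y * y)) ((1/2) *\<^sub>R (c + z * z))
      = (1/2) * norm (y * (y - z) + (y - z) * z)"
    by (simp add: dist_norm)
  also have "\<dots> \<le> (1/2) * (norm y * norm (y - z) + norm (y - z) * norm z)"
    by (intro mult_left_mono norm_triangle_le add_mono norm_mult_ineq) auto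
  also have "\<dots> \<le> (1/2) * (r * norm (y - z) + norm (y - z) * r)"
    using assms by (intro mult_left_mono add_mono mult_right_mono) auto
  finally show ?thesis by (simp add: dist_norm)
qed

locale cstar_algebra =
  fixes st :: "'a::complex_banach_algebra_1 \<Rightarrow> 'a"
  assumes involution: "cstar_involution st"
begin

lemma st_add: "st (a + b) = st a + st b"
  and st_scaleC: "st (c *\<^sub>C a) = cnj c *\<^sub>C st a"
  and st_mult: "st (a * b) = st b * st a"
  and st_st [simp]: "st (st a) = a"
  and norm_st_mult: "norm (st a * a) = norm a ^ 2"
  using involution by (auto simp: cstar_involution_def)

lemma st_scaleR: "st (r *\<^sub>R a) = r *\<^sub>R st a"
  by (simp add: scaleR_scaleC st_scaleC)

lemma st_zero [simp]: "st 0 = 0"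
  using st_add[of 0 0] by simp

lemma st_one [simp]: "st 1 = 1"
  using st_mult[of 1 "st 1"] by simp

lemma st_diff: "st (a - b) = st a - st b"
  using st_add[of "a - b" b] by simp

lemma norm_st [simp]: "norm (st a) = norm a"
proof -
  have "norm a \<le> norm (st a)" for a
  proof (cases "a = 0")
    case False
    have "norm a * norm a \<le> norm (st a) * norm a"
      using norm_mult_ineq[of "st a" a] by (simp add: norm_st_mult power2_eq_square)
    then show ?thesis using False by simp
  qed simp
  from this[of a] this[of "st a"] show ?thesis by simp
qed

lemma bounded_linear_st: "bounded_linear st"
  by (rule bounded_linear_intro[of _ 1]) (auto simp: st_add st_scaleR)

lemma norm_square_selfadjoint: "st a = a \<Longrightarrow> norm (a * a) = norm a ^ 2"
  using norm_st_mult[of a] by simp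

lemma st_power: "st (a ^ n) = st a ^ n"
  by (induction n) (auto simp: st_mult power_commutes)

lemma norm_dyadic_power:
  assumes "st a = a" shows "norm (a ^ (2 ^ k)) = norm a ^ (2 ^ k)"
proof (induction k)
  case (Suc k)
  have "norm (a ^ (2 ^ k) * a ^ (2 ^ k)) = norm (a ^ (2 ^ k)) ^ 2"
    by (rule norm_square_selfadjoint) (simp add: st_power assms)
  then show ?case by (simp add: Suc power_add[symmetric] mult_2 power2_eq_square)
qed simp

lemma st_poly_alg: "st a = a \<Longrightarrow> st (poly_alg p a) = poly_alg p a"
  by (induction p) (auto simp: st_add st_mult st_scaleR poly_alg_commute)

text \<open>The root is \<open>1 - y\<close> for the fixed point \<open>y\<close> of the contraction \<open>y \<mapsto> (a\<^sup>2 + y\<^sup>2) / 2\<close>.\<close>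

lemma sqrt_one_minus_square:
  assumes a: "st a = a" "norm a < 1"
  shows "\<exists>w. st w = w \<and> w * a = a * w \<and> w * w = 1 - a * a"
proof -
  define S where "S = cball 0 (norm a) \<inter> {y. st y = y} \<inter> {y. y * a = a * y}"
  define f where "f y = (1/2) *\<^sub>R (a * a + y * y)" for y
  have "\<exists>!y\<in>S. f y = y"
  proof (rule Banach_fix[of _ "norm a"])
    show "complete S" unfolding S_def complete_eq_closed
      by (intro closed_Int closed_cball closed_Collect_eq continuous_intros
          bounded_linear.continuous_on[OF bounded_linear_st])
    have "0 \<in> S" by (simp add: S_def)
    then show "S \<noteq> {}" by blast
    show "f ` S \<subseteq> S"
    proof safe
      fix y assume "y \<in> S"
      then have y: "norm y \<le> norm a" "st y = y" "y * a = a * y" by (simp_all add: S_def)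
      have "norm (f y) \<le> norm a * norm a"
        unfolding f_def using y(1) by (intro norm_half_add_square_le) simp_all
      also have "\<dots> \<le> norm a" using a(2) by (simp add: mult_left_le)
      finally have "norm (f y) \<le> norm a" .
      moreover have "y * y * a = a * (y * y)" by (metis mult.assoc y(3))
      ultimately show "f y \<in> S"
        using y a(1) by (auto simp: S_def f_def st_scaleR st_add st_mult algebra_simps)
    qed
    show "dist (f y) (f z) \<le> norm a * dist y z" if "y \<in> S" "z \<in> S" for y z
      unfolding f_def using that by (intro dist_half_add_square_le) (simp_all add: S_def)
  qed (use a in auto)
  then obtain y where y: "y \<in> S" "f y = y" by blast
  have "y * y = 2 *\<^sub>R f y - a * a" by (simp add: f_def)
  then have "(1 - y) * (1 - y) = 1 - a * a" by (simp add: y(2) algebra_simps scaleR_2)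
  moreover have "st (1 - y) = 1 - y" "(1 - y) * a = a * (1 - y)"
    using y(1) by (auto simp: S_def st_diff algebra_simps)
  ultimately show ?thesis by blast
qed

lemma selfadjoint_eq_average_of_unitary:
  assumes a: "st a = a" "norm a < 1"
  obtains u v where "u * v = 1" "v * u = 1" "norm u = 1" "norm v = 1" "a = (1/2) *\<^sub>R (u + v)"
proof -
  obtain w where w: "st w = w" "w * a = a * w" "w * w = 1 - a * a"
    using sqrt_one_minus_square[OF a] by blast
  define u where "u = a + \<i> *\<^sub>C w"
  define v where "v = a - \<i> *\<^sub>C w"
  have inverses: "u * v = 1" "v * u = 1"
    using w(2,3) by (auto simp: u_def v_def algebra_simps mult_scaleC_left mult_scaleC_right
        scaleC.add_right scaleC.diff_right scaleC_scaleC scaleC_minus_one)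
  have "st u = v" "st v = u"
    by (auto simp: u_def v_def st_add st_diff st_scaleC a w(1) scaleC.minus_left)
  then have "norm u ^ 2 = 1" "norm v ^ 2 = 1"
    using norm_st_mult[of u] norm_st_mult[of v] inverses by auto
  then have "norm u = 1" "norm v = 1" by (auto intro: power2_eq_imp_eq)
  moreover have "a = (1/2) *\<^sub>R (u + v)" by (simp add: u_def v_def scaleR_half_double)
  ultimately show ?thesis using that inverses by blast
qed

lemma norm_poly_alg_le_degree_mult:
  assumes a: "st a = a" "norm a < 1" and M: "\<And>t. \<bar>t\<bar> \<le> 1 \<Longrightarrow> \<bar>poly p t\<bar> \<le> M"
  shows "norm (poly_alg p a) \<le> (2 * real (degree p) + 1) * M"
proof -
  obtain u v where uv: "u * v = 1" "v * u = 1" "norm u = 1" "norm v = 1" "a = (1/2) *\<^sub>R (u + v)"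
    by (rule selfadjoint_eq_average_of_unitary[OF a])
  have "M \<ge> 0" using order_trans[OF abs_ge_zero M[of 0]] by simp
  have "poly_alg p a = (v ^ degree p * u ^ degree p) * poly_alg p a"
    using uv by (simp add: left_right_inverse_power)
  also have "\<dots> = v ^ degree p * poly_alg (joukowski_lift p) u"
    using poly_alg_joukowski_lift[OF uv(1,2), of p] by (simp add: uv(5) mult.assoc)
  finally have "norm (poly_alg p a) \<le> norm (v ^ degree p) * norm (poly_alg (joukowski_lift p) u)"
    by (metis norm_mult_ineq)
  also have "\<dots> \<le> 1 * norm (poly_alg (joukowski_lift p) u)"
    using norm_power_ineq[of v "degree p"] uv(4) by (intro mult_right_mono) auto
  also have "norm (poly_alg (joukowski_lift p) u) \<le> (real (degree (joukowski_lift p)) + 1) * M"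
    using coeff_joukowski_lift_le[OF M] uv(3) by (intro norm_poly_alg_le_coeff_bound) auto
  also have "\<dots> \<le> (2 * real (degree p) + 1) * M"
    using degree_joukowski_lift_le[of p] \<open>M \<ge> 0\<close> by (intro mult_right_mono) auto
  finally show ?thesis by simp
qed

lemma norm_poly_alg_le_unit:
  assumes a: "st a = a" "norm a < 1" and M: "\<And>t. \<bar>t\<bar> \<le> 1 \<Longrightarrow> \<bar>poly p t\<bar> \<le> M"
  shows "norm (poly_alg p a) \<le> M"
proof (rule le_if_dyadic_powers_le[where c = "2 * real (degree p)"])
  show M_nonneg: "M \<ge> 0" using order_trans[OF abs_ge_zero M[of 0]] by simp
  fix n
  have "norm (poly_alg p a) ^ (2 ^ n) = norm (poly_alg (p ^ (2 ^ n)) a)"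
    using norm_dyadic_power[OF st_poly_alg[OF a(1)]] by (simp add: poly_alg_power)
  also have "\<dots> \<le> (2 * real (degree (p ^ (2 ^ n))) + 1) * M ^ (2 ^ n)"
    using M by (intro norm_poly_alg_le_degree_mult[OF a]) (auto simp: power_abs intro: power_mono)
  also have "\<dots> \<le> (2 * real (degree p) * 2 ^ n + 1) * M ^ (2 ^ n)"
  proof (intro mult_right_mono add_right_mono)
    have "real (degree (p ^ (2 ^ n))) \<le> real (degree p * 2 ^ n)"
      using degree_power_le[of p "2 ^ n"] by (simp only: of_nat_le_iff)
    then show "2 * real (degree (p ^ (2 ^ n))) \<le> 2 * real (degree p) * 2 ^ n" by simp
  qed (use M_nonneg in simp)
  finally show "norm (poly_alg p a) ^ (2 ^ n) \<le> (2 * real (degree p) * 2 ^ n + 1) * M ^ (2 ^ n)" .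
qed

theorem norm_poly_alg_le:
  assumes a: "st a = a" "norm (a - c *\<^sub>R 1) \<le> r"
    and M: "\<And>t. \<bar>t - c\<bar> \<le> r \<Longrightarrow> \<bar>poly p t\<bar> \<le> M"
  shows "norm (poly_alg p a) \<le> M"
proof -
  define b where "b = a - c *\<^sub>R 1"
  have bound: "norm (poly_alg p (c *\<^sub>R 1 + s *\<^sub>R b)) \<le> M" if s: "0 \<le> s" "s < 1" for s
  proof -
    have b: "norm b \<le> r" using a(2) by (simp add: b_def)
    then have r: "r \<ge> 0" "r = 0 \<longrightarrow> b = 0" using order_trans[OF norm_ge_zero b] by auto
    have "norm ((s / r) *\<^sub>R b) \<le> s"
      using b r s mult_left_mono[OF b, of s] by (cases "r = 0") (auto simp: divide_le_eq mult.commute)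
    moreover have "st ((s / r) *\<^sub>R b) = (s / r) *\<^sub>R b"
      by (simp add: b_def st_scaleR st_diff a(1))
    moreover have "\<bar>poly (pcompose p [:c, r:]) t\<bar> \<le> M" if "\<bar>t\<bar> \<le> 1" for t
      unfolding poly_pcompose using that r(1) by (intro M) (simp add: abs_mult mult_left_le_one_le)
    ultimately have "norm (poly_alg (pcompose p [:c, r:]) ((s / r) *\<^sub>R b)) \<le> M"
      using s by (intro norm_poly_alg_le_unit) auto
    moreover have "poly_alg [:c, r:] ((s / r) *\<^sub>R b) = c *\<^sub>R 1 + s *\<^sub>R b"
      using r(2) by (cases "r = 0") auto
    ultimately show ?thesis by (simp only: poly_alg_pcompose)
  qed
  have "((\<lambda>s. norm (poly_alg p (c *\<^sub>R 1 + s *\<^sub>R b))) \<longlongrightarrow> norm (poly_alg p (c *\<^sub>R 1 + 1 *\<^sub>R b))) (at_left 1)"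
    by (intro tendsto_intros tendsto_poly_alg)
  moreover have "eventually (\<lambda>s. norm (poly_alg p (c *\<^sub>R 1 + s *\<^sub>R b)) \<le> M) (at_left 1)"
    using bound by (auto simp: eventually_at_left_field intro!: exI[of _ 0])
  ultimately show ?thesis by (auto simp: b_def dest: tendsto_upperbound)
qed

end

section \<open>Invertibility and spectra\<close>

lemma invertible_elI: "a * b = 1 \<Longrightarrow> b * a = 1 \<Longrightarrow> invertible_el a"
  by (auto simp: invertible_el_def)

lemma invertible_el_mult:
  assumes "invertible_el a" "invertible_el b" shows "invertible_el (a * b)"
proof -
  obtain a' b' where "a * a' = 1" "a' * a = 1" "b * b' = 1" "b' * b = 1"
    using assms by (auto simp: invertible_el_def)
  moreover have "a * b * (b' * a') = a * (b * b') * a'" "b' * a' * (a * b) = b' * (a' * a) * b"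
    by (simp_all only: mult.assoc)
  ultimately show ?thesis by (intro invertible_elI[of _ "b' * a'"]) auto
qed

lemma invertible_el_one_minus:
  fixes x :: "'a::{real_normed_algebra_1, banach}"
  assumes "norm x < 1" shows "invertible_el (1 - x)"
proof -
  have summable: "summable (\<lambda>n. x ^ n)"
    by (rule summable_comparison_test'[of "\<lambda>n. norm x ^ n"])
      (use assms in \<open>auto intro: norm_power_ineq\<close>)
  let ?s = "\<Sum>n. x ^ n"
  have "?s = (\<Sum>n. x ^ Suc n) + 1" using suminf_split_head[OF summable] by simp
  moreover have "x * ?s = (\<Sum>n. x * x ^ n)" by (rule suminf_mult[symmetric, OF summable])
  moreover have "?s * x = (\<Sum>n. x ^ n * x)" by (rule suminf_mult2[OF summable])
  ultimately have "x * ?s = ?s - 1" "?s * x = ?s - 1" by (simp_all add: power_commutes)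
  then show ?thesis by (intro invertible_elI[of _ ?s]) (auto simp: algebra_simps)
qed

lemma (in cstar_algebra) invertible_el_st: "invertible_el a \<Longrightarrow> invertible_el (st a)"
  unfolding invertible_el_def by (metis st_mult st_one)

definition bounded_below :: "real \<Rightarrow> 'a::real_normed_algebra \<Rightarrow> bool" where
  "bounded_below m a \<longleftrightarrow> (\<forall>x. m * norm x \<le> norm (a * x))"

lemma bounded_below_mono: "bounded_below m a \<Longrightarrow> m' \<le> m \<Longrightarrow> bounded_below m' a"
  unfolding bounded_below_def by (meson mult_right_mono norm_ge_zero order_trans)

lemma bounded_below_add:
  assumes "bounded_below m a" shows "bounded_below (m - norm b) (a + b)"
  unfolding bounded_below_def
proof
  fix x
  have "m * norm x \<le> norm (a * x)" using assms by (simp add: bounded_below_def)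
  also have "\<dots> \<le> norm ((a + b) * x) + norm (b * x)"
    using norm_triangle_ineq4[of "(a + b) * x" "b * x"] by (simp add: algebra_simps)
  also have "norm (b * x) \<le> norm b * norm x" by (rule norm_mult_ineq)
  finally show "(m - norm b) * norm x \<le> norm ((a + b) * x)" by (simp add: algebra_simps)
qed

lemma invertible_el_imp_bounded_below:
  fixes a :: "'a::real_normed_algebra_1"
  assumes "invertible_el a" shows "\<exists>m>0. bounded_below m a"
proof -
  obtain b where b: "b * a = 1" using assms by (auto simp: invertible_el_def)
  then have "norm b > 0" by auto
  have "1 / norm b * norm x \<le> norm (a * x)" for x
  proof -
    have "norm x = norm (b * (a * x))" by (simp add: b flip: mult.assoc)
    also have "\<dots> \<le> norm b * norm (a * x)" by (rule norm_mult_ineq)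
    finally show ?thesis using \<open>norm b > 0\<close> by (simp add: field_simps)
  qed
  then show ?thesis
    using \<open>norm b > 0\<close> by (intro exI[of _ "1 / norm b"]) (simp add: bounded_below_def)
qed

lemma spec_norm_le:
  assumes "l \<in> spec a" shows "cmod l \<le> norm a"
proof (rule ccontr)
  assume "\<not> ?thesis"
  then have less: "norm a < cmod l" by simp
  then have "l \<noteq> 0" by auto
  then have "invertible_el ((- l) *\<^sub>C (1::'a))"
    by (intro invertible_elI[of _ "(- 1 / l) *\<^sub>C 1"])
      (auto simp: mult_scaleC_left scaleC_scaleC scaleC_one)
  moreover have "norm ((1 / l) *\<^sub>C a) < 1"
    using less \<open>l \<noteq> 0\<close> by (auto simp: norm_scaleC norm_divide divide_less_eq)
  ultimately have "invertible_el ((- l) *\<^sub>C 1 * (1 - (1 / l) *\<^sub>C a))"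
    by (intro invertible_el_mult invertible_el_one_minus)
  also have "(- l) *\<^sub>C 1 * (1 - (1 / l) *\<^sub>C a) = a - l *\<^sub>C 1"
    using \<open>l \<noteq> 0\<close>
    by (simp add: mult_scaleC_left scaleC.diff_right scaleC_scaleC scaleC.minus_left scaleC_one)
  finally show False using assms by (simp add: spec_def)
qed

section \<open>Continuous functions of a selfadjoint element\<close>

lemma uniform_limit_real_polys:
  fixes f :: "real \<Rightarrow> real"
  assumes "continuous_on UNIV f"
  obtains P where "uniform_limit (cball 0 R) (\<lambda>n. poly (P n)) f sequentially"
proof -
  obtain g where g: "uniform_limit (cball 0 R) g f sequentially" "\<And>n. polynomial_function (g n)"
    using Stone_Weierstrass_uniform_limit[of "cball 0 R" f] continuous_on_subset[OF assms] by auto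
  have "\<exists>p. poly p = g n" for n
  proof -
    obtain c k where "g n = (\<lambda>t. \<Sum>i\<le>k. c i * t ^ i)"
      using g(2)[of n]
      by (auto simp: real_polynomial_function_eq[symmetric] real_polynomial_function_iff_sum)
    then have "poly (\<Sum>i\<le>k. monom (c i) i) = g n" by (simp add: fun_eq_iff poly_sum poly_monom)
    then show ?thesis ..
  qed
  then obtain P where "\<forall>n. poly (P n) = g n" by metis
  then show ?thesis using that[of P] g(1) by simp
qed

text \<open>For every polynomial \<open>p\<close>, the element \<open>p a\<close> is as close to \<open>cfc f a\<close> as \<open>p\<close> is to \<open>f\<close> on
  \<open>[- norm a, norm a]\<close>. This determines \<open>cfc f a\<close> if \<open>a\<close> is selfadjoint and \<open>f\<close> is continuous.\<close>

definition is_cfc :: "(real \<Rightarrow> real) \<Rightarrow> 'a::real_normed_algebra_1 \<Rightarrow> 'a \<Rightarrow> bool" where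
  "is_cfc f a b \<longleftrightarrow> (\<forall>p e. (\<forall>t. \<bar>t\<bar> \<le> norm a \<longrightarrow> \<bar>poly p t - f t\<bar> \<le> e) \<longrightarrow> norm (poly_alg p a - b) \<le> e)"

definition cfc :: "(real \<Rightarrow> real) \<Rightarrow> 'a::real_normed_algebra_1 \<Rightarrow> 'a" where
  "cfc f a = (THE b. is_cfc f a b)"

lemma is_cfcD:
  "is_cfc f a b \<Longrightarrow> (\<And>t. \<bar>t\<bar> \<le> norm a \<Longrightarrow> \<bar>poly p t - f t\<bar> \<le> e) \<Longrightarrow> norm (poly_alg p a - b) \<le> e"
  by (simp add: is_cfc_def)

lemma is_cfc_tendsto:
  assumes b: "is_cfc f a b" and P: "uniform_limit (cball 0 (norm a)) (\<lambda>n. poly (P n)) f F"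
  shows "((\<lambda>n. poly_alg (P n) a) \<longlongrightarrow> b) F"
proof (rule tendstoI)
  fix e :: real assume "e > 0"
  from uniform_limitD[OF P half_gt_zero[OF this]] show "\<forall>\<^sub>F n in F. dist (poly_alg (P n) a) b < e"
  proof eventually_elim
    case (elim n)
    then have "norm (poly_alg (P n) a - b) \<le> e / 2"
      by (intro is_cfcD[OF b]) (auto simp: dist_real_def intro: less_imp_le)
    then show ?case using \<open>e > 0\<close> by (simp add: dist_norm)
  qed
qed

definition tent :: "real \<Rightarrow> real \<Rightarrow> real \<Rightarrow> real" where
  "tent \<delta> s t = max 0 (1 - \<bar>t - s\<bar> / \<delta>)"

lemma continuous_on_tent: "continuous_on UNIV (tent \<delta> s)"
  by (cases "\<delta> = 0") (auto simp: tent_def[abs_def] intro!: continuous_intros)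

lemma tent_support: "\<delta> > 0 \<Longrightarrow> tent \<delta> s t \<noteq> 0 \<Longrightarrow> \<bar>t - s\<bar> \<le> \<delta>"
  by (auto simp: tent_def max_def divide_less_eq split: if_splits)

context cstar_algebra
begin

lemma norm_poly_alg_diff_le:
  assumes "st a = a" "norm a \<le> R" "\<And>t. \<bar>t\<bar> \<le> R \<Longrightarrow> \<bar>poly p t - poly q t\<bar> \<le> e"
  shows "norm (poly_alg p a - poly_alg q a) \<le> e"
  using norm_poly_alg_le[of a 0 R "p - q" e] assms by (simp add: poly_alg_diff)

lemma convergent_poly_alg:
  assumes a: "st a = a" and P: "uniform_limit (cball 0 (norm a)) (\<lambda>n. poly (P n)) f sequentially"
  shows "convergent (\<lambda>n. poly_alg (P n) a)"
proof -
  have "Cauchy (\<lambda>n. poly_alg (P n) a)"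
  proof (rule CauchyI)
    fix e :: real assume "e > 0"
    then obtain N where "\<forall>n\<ge>N. \<forall>t\<in>cball 0 (norm a). dist (poly (P n) t) (f t) < e / 3"
      using uniform_limitD[OF P, of "e / 3"] unfolding eventually_sequentially by auto
    then have N: "\<bar>poly (P n) t - f t\<bar> < e / 3" if "n \<ge> N" "\<bar>t\<bar> \<le> norm a" for n t
      using that by (simp add: dist_real_def)
    have "norm (poly_alg (P m) a - poly_alg (P n) a) < e" if "m \<ge> N" "n \<ge> N" for m n
    proof -
      have "\<bar>poly (P m) t - poly (P n) t\<bar> \<le> 2 * e / 3" if "\<bar>t\<bar> \<le> norm a" for t
        using N[OF \<open>m \<ge> N\<close> that] N[OF \<open>n \<ge> N\<close> that] by linarith
      then have "norm (poly_alg (P m) a - poly_alg (P n) a) \<le> 2 * e / 3"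
        by (rule norm_poly_alg_diff_le[OF a order_refl])
      then show ?thesis using \<open>e > 0\<close> by simp
    qed
    then show "\<exists>N. \<forall>m\<ge>N. \<forall>n\<ge>N. norm (poly_alg (P m) a - poly_alg (P n) a) < e" by blast
  qed
  then show ?thesis by (simp add: Cauchy_convergent_iff)
qed

lemma is_cfc_limit:
  assumes a: "st a = a" and P: "uniform_limit (cball 0 (norm a)) (\<lambda>n. poly (P n)) f sequentially"
    and b: "(\<lambda>n. poly_alg (P n) a) \<longlonglongrightarrow> b"
  shows "is_cfc f a b"
  unfolding is_cfc_def
proof (intro allI impI, rule field_le_epsilon)
  fix p and e d :: real
  assume p: "\<forall>t. \<bar>t\<bar> \<le> norm a \<longrightarrow> \<bar>poly p t - f t\<bar> \<le> e" and "d > 0"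
  have "\<forall>\<^sub>F n in sequentially. norm (poly_alg p a - poly_alg (P n) a) \<le> e + d"
    using uniform_limitD[OF P \<open>d > 0\<close>]
  proof eventually_elim
    case (elim n)
    show ?case
    proof (rule norm_poly_alg_diff_le[OF a order_refl])
      fix t assume "\<bar>t\<bar> \<le> norm a"
      then have "\<bar>poly p t - f t\<bar> \<le> e" "\<bar>poly (P n) t - f t\<bar> < d"
        using p elim by (auto simp: dist_real_def)
      then show "\<bar>poly p t - poly (P n) t\<bar> \<le> e + d" by linarith
    qed
  qed
  then show "norm (poly_alg p a - b) \<le> e + d"
    by (intro tendsto_upperbound[OF tendsto_norm[OF tendsto_diff[OF tendsto_const b]]]) auto
qed

lemma is_cfc_cfc:
  assumes a: "st a = a" and f: "continuous_on UNIV f" shows "is_cfc f a (cfc f a)"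
proof -
  obtain P where P: "uniform_limit (cball 0 (norm a)) (\<lambda>n. poly (P n)) f sequentially"
    by (rule uniform_limit_real_polys[OF f])
  obtain b where b: "(\<lambda>n. poly_alg (P n) a) \<longlonglongrightarrow> b"
    using convergent_poly_alg[OF a P] by (auto simp: convergent_def)
  have "is_cfc f a b" by (rule is_cfc_limit[OF a P b])
  moreover have "b' = b" if "is_cfc f a b'" for b'
    using is_cfc_tendsto[OF that P] b by (rule LIMSEQ_unique)
  ultimately show ?thesis unfolding cfc_def by (rule theI)
qed

lemma norm_poly_alg_diff_cfc_le:
  assumes "st a = a" "continuous_on UNIV f" "norm a \<le> R"
    and "\<And>t. \<bar>t\<bar> \<le> R \<Longrightarrow> \<bar>poly p t - f t\<bar> \<le> e"
  shows "norm (poly_alg p a - cfc f a) \<le> e"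
  by (rule is_cfcD[OF is_cfc_cfc]) (use assms in auto)

lemma tendsto_cfc:
  assumes "st a = a" "continuous_on UNIV f" "norm a \<le> R"
    and P: "uniform_limit (cball 0 R) (\<lambda>n. poly (P n)) f F"
  shows "((\<lambda>n. poly_alg (P n) a) \<longlongrightarrow> cfc f a) F"
  by (rule is_cfc_tendsto[OF is_cfc_cfc[OF assms(1,2)]
      uniform_limit_on_subset[OF P subset_cball[OF assms(3)]]])

lemma cfc_poly: "st a = a \<Longrightarrow> cfc (poly p) a = poly_alg p a"
  using norm_poly_alg_diff_cfc_le[of a "poly p" "norm a" p 0] by (simp add: continuous_on_poly)

lemma cfc_add:
  assumes a: "st a = a" and f: "continuous_on UNIV f" and g: "continuous_on UNIV g"
  shows "cfc (\<lambda>t. f t + g t) a = cfc f a + cfc g a"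
proof -
  obtain P Q where P: "uniform_limit (cball 0 (norm a)) (\<lambda>n. poly (P n)) f sequentially"
    and Q: "uniform_limit (cball 0 (norm a)) (\<lambda>n. poly (Q n)) g sequentially"
    using uniform_limit_real_polys[OF f] uniform_limit_real_polys[OF g] by metis
  have "uniform_limit (cball 0 (norm a)) (\<lambda>n. poly (P n + Q n)) (\<lambda>t. f t + g t) sequentially"
    using uniform_limit_add[OF P Q] by (simp add: poly_add[abs_def])
  then have "(\<lambda>n. poly_alg (P n + Q n) a) \<longlonglongrightarrow> cfc (\<lambda>t. f t + g t) a"
    by (intro tendsto_cfc[OF a] continuous_intros f g) auto
  moreover have "(\<lambda>n. poly_alg (P n + Q n) a) \<longlonglongrightarrow> cfc f a + cfc g a"
    unfolding poly_alg_add by (intro tendsto_add tendsto_cfc[OF a _ order_refl] f g P Q)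
  ultimately show ?thesis by (rule LIMSEQ_unique)
qed

lemma cfc_mult:
  assumes a: "st a = a" and f: "continuous_on UNIV f" and g: "continuous_on UNIV g"
  shows "cfc (\<lambda>t. f t * g t) a = cfc f a * cfc g a"
proof -
  obtain P Q where P: "uniform_limit (cball 0 (norm a)) (\<lambda>n. poly (P n)) f sequentially"
    and Q: "uniform_limit (cball 0 (norm a)) (\<lambda>n. poly (Q n)) g sequentially"
    using uniform_limit_real_polys[OF f] uniform_limit_real_polys[OF g] by metis
  have "bounded (h ` cball 0 (norm a))" if "continuous_on UNIV h" for h :: "real \<Rightarrow> real"
    using continuous_on_subset[OF that] by (intro compact_imp_bounded compact_continuous_image) auto
  then have "uniform_limit (cball 0 (norm a)) (\<lambda>n. poly (P n * Q n)) (\<lambda>t. f t * g t) sequentially"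
    using uniform_lim_mult[OF P Q] f g by (simp add: poly_mult[abs_def])
  then have "(\<lambda>n. poly_alg (P n * Q n) a) \<longlonglongrightarrow> cfc (\<lambda>t. f t * g t) a"
    by (intro tendsto_cfc[OF a] continuous_intros f g) auto
  moreover have "(\<lambda>n. poly_alg (P n * Q n) a) \<longlonglongrightarrow> cfc f a * cfc g a"
    unfolding poly_alg_mult by (intro tendsto_mult tendsto_cfc[OF a _ order_refl] f g P Q)
  ultimately show ?thesis by (rule LIMSEQ_unique)
qed

lemma cfc_commute:
  assumes a: "st a = a" and f: "continuous_on UNIV f" and comm: "b * a = a * b"
  shows "b * cfc f a = cfc f a * b"
proof -
  obtain P where P: "uniform_limit (cball 0 (norm a)) (\<lambda>n. poly (P n)) f sequentially"
    by (rule uniform_limit_real_polys[OF f])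
  have lim: "(\<lambda>n. poly_alg (P n) a) \<longlonglongrightarrow> cfc f a" by (rule tendsto_cfc[OF a f order_refl P])
  have "(\<lambda>n. b * poly_alg (P n) a) \<longlonglongrightarrow> b * cfc f a" by (intro tendsto_intros lim)
  moreover have "(\<lambda>n. b * poly_alg (P n) a) \<longlonglongrightarrow> cfc f a * b"
    unfolding poly_alg_commute[OF comm] by (intro tendsto_intros lim)
  ultimately show ?thesis by (rule LIMSEQ_unique)
qed

lemma cfc_const: "st a = a \<Longrightarrow> cfc (\<lambda>t. c) a = c *\<^sub>R 1"
  using cfc_poly[of a "[:c:]"] by (simp add: poly_pCons[abs_def] del: poly_pCons)

lemma cfc_sum:
  assumes "st a = a" "\<And>i. i \<in> I \<Longrightarrow> continuous_on UNIV (f i)"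
  shows "cfc (\<lambda>t. \<Sum>i\<in>I. f i t) a = (\<Sum>i\<in>I. cfc (f i) a)"
  using assms(2)
proof (induction I rule: infinite_finite_induct)
  case (insert i I)
  then show ?case by (simp add: cfc_add[OF assms(1)] continuous_on_sum)
qed (simp_all add: cfc_const[OF assms(1)])

lemma norm_cfc_le:
  assumes a: "st a = a" "norm (a - c *\<^sub>R 1) \<le> r" and f: "continuous_on UNIV f"
    and M: "\<And>t. \<bar>t - c\<bar> \<le> r \<Longrightarrow> \<bar>f t\<bar> \<le> M"
  shows "norm (cfc f a) \<le> M"
proof (rule field_le_epsilon)
  fix e :: real assume "e > 0"
  define R where "R = max (norm a) (\<bar>c\<bar> + r)"
  obtain P where P: "uniform_limit (cball 0 R) (\<lambda>n. poly (P n)) f sequentially"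
    by (rule uniform_limit_real_polys[OF f])
  have "(\<lambda>n. norm (poly_alg (P n) a)) \<longlonglongrightarrow> norm (cfc f a)"
    by (intro tendsto_norm tendsto_cfc[OF a(1) f _ P]) (simp add: R_def)
  moreover have "\<forall>\<^sub>F n in sequentially. norm (poly_alg (P n) a) \<le> M + e"
    using uniform_limitD[OF P \<open>e > 0\<close>]
  proof eventually_elim
    case (elim n)
    show ?case
    proof (rule norm_poly_alg_le[OF a])
      fix t assume t: "\<bar>t - c\<bar> \<le> r"
      then have "\<bar>poly (P n) t - f t\<bar> < e" using elim by (auto simp: R_def dist_real_def)
      then show "\<bar>poly (P n) t\<bar> \<le> M + e" using M[OF t] by linarith
    qed
  qed
  ultimately show "norm (cfc f a) \<le> M + e" by (rule tendsto_upperbound) simp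
qed

lemma cfc_eq_const:
  assumes a: "st a = a" "norm (a - c *\<^sub>R 1) \<le> r" and f: "continuous_on UNIV f"
    and d: "\<And>t. \<bar>t - c\<bar> \<le> r \<Longrightarrow> f t = d"
  shows "cfc f a = d *\<^sub>R 1"
proof -
  have "norm (cfc (\<lambda>t. f t + (- d)) a) \<le> 0"
    by (rule norm_cfc_le[OF a]) (use d in \<open>auto intro!: continuous_intros f\<close>)
  then show ?thesis unfolding cfc_add[OF a(1) f continuous_on_const] by (simp add: cfc_const a(1))
qed

lemma norm_cfc_mult_le_on_support:
  assumes a: "st a = a" and f: "continuous_on UNIV f" and g: "continuous_on UNIV g"
    and \<delta>: "\<delta> \<ge> 0" "\<And>t. f t \<noteq> 0 \<Longrightarrow> \<bar>g t\<bar> \<le> \<delta>"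
  shows "norm (cfc g a * (cfc f a * b)) \<le> \<delta> * norm (cfc f a * b)"
proof -
  define g' where "g' t = max (- \<delta>) (min \<delta> (g t))" for t
  have g': "continuous_on UNIV g'" unfolding g'_def by (intro continuous_intros g)
  have "(\<lambda>t. g t * f t) = (\<lambda>t. g' t * f t)"
  proof
    fix t show "g t * f t = g' t * f t"
      using \<delta>(2)[of t] by (cases "f t = 0") (auto simp: g'_def)
  qed
  then have "cfc g a * cfc f a = cfc g' a * cfc f a"
    using cfc_mult[OF a g f] cfc_mult[OF a g' f] by simp
  then have "cfc g a * (cfc f a * b) = cfc g' a * (cfc f a * b)" by (simp flip: mult.assoc)
  then have "norm (cfc g a * (cfc f a * b)) \<le> norm (cfc g' a) * norm (cfc f a * b)"
    by (simp add: norm_mult_ineq)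
  also have "norm (cfc g' a) \<le> \<delta>"
    using \<delta>(1) by (intro norm_cfc_le[OF a _ g', of 0 "norm a"]) (auto simp: g'_def)
  finally show ?thesis by (simp add: mult_right_mono)
qed

lemma cfc_eq_0_if_bounded_below:
  assumes a: "st a = a" and f: "continuous_on UNIV f" and g: "continuous_on UNIV g"
    and below: "bounded_below m (cfc g a)"
    and \<delta>: "0 \<le> \<delta>" "\<delta> < m" "\<And>t. f t \<noteq> 0 \<Longrightarrow> \<bar>g t\<bar> \<le> \<delta>"
  shows "cfc f a = 0"
proof (rule ccontr)
  assume "\<not> ?thesis"
  then have "\<delta> * norm (cfc f a) < m * norm (cfc f a)" using \<delta>(2) by simp
  also have "\<dots> \<le> norm (cfc g a * cfc f a)" using below by (simp add: bounded_below_def)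
  also have "\<dots> \<le> \<delta> * norm (cfc f a)"
    using norm_cfc_mult_le_on_support[OF a f g \<delta>(1,3), of 1] by simp
  finally show False by simp
qed

lemma cfc_tent_eq_0_if_bounded_below:
  assumes a: "st a = a" and below: "bounded_below m (poly_alg p a - s *\<^sub>R 1)" and \<delta>: "0 < \<delta>" "\<delta> < m"
  shows "cfc (\<lambda>t. tent \<delta> s (poly p t)) a = 0"
proof (rule cfc_eq_0_if_bounded_below[OF a _ _ _ _ \<delta>(2)])
  show "bounded_below m (cfc (poly (p - [:s:])) a)"
    using below by (simp only: cfc_poly[OF a]) (simp add: poly_alg_diff)
  show "continuous_on UNIV (\<lambda>t. tent \<delta> s (poly p t))"
    by (intro continuous_on_compose2[OF continuous_on_tent] continuous_intros) simp
  show "\<bar>poly (p - [:s:]) t\<bar> \<le> \<delta>" if "tent \<delta> s (poly p t) \<noteq> 0" for t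
    using tent_support[OF \<delta>(1) that] by simp
qed (use \<delta> in \<open>auto intro!: continuous_intros\<close>)

text \<open>If \<open>r = norm a\<^sup>2\<close> were not in the spectrum, functions supported near \<open>r\<close> would vanish on \<open>a\<^sup>2\<close>,
  so that cutting off \<open>a\<^sup>2\<close> just below \<open>r\<close> would change nothing.\<close>

lemma norm_square_in_spec:
  assumes a: "st a = a" shows "of_real (norm a ^ 2) \<in> spec (a * a)"
proof (rule ccontr)
  define r where "r = norm a ^ 2"
  assume "\<not> ?thesis"
  then have inv: "invertible_el (a * a - r *\<^sub>R 1)" by (simp add: spec_def r_def scaleR_scaleC)
  then have "r \<noteq> 0" by (auto simp: r_def invertible_el_def)
  then have "r > 0" by (simp add: r_def)
  obtain m where m: "m > 0" "bounded_below m (a * a - r *\<^sub>R 1)"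
    using invertible_el_imp_bounded_below[OF inv] by blast
  define \<delta> where "\<delta> = min (m / 2) r"
  have \<delta>: "0 < \<delta>" "\<delta> \<le> r" "\<delta> < m" using m(1) \<open>r > 0\<close> by (auto simp: \<delta>_def)
  define high where "high t = tent \<delta> r (poly [:0, 0, 1:] t)" for t
  define low where "low t = poly [:0, 0, 1:] t - \<delta> * high t" for t
  have cont: "continuous_on UNIV high" "continuous_on UNIV low"
    unfolding low_def high_def
    by (intro continuous_intros continuous_on_compose2[OF continuous_on_tent] subset_UNIV)+
  have "cfc high a = 0"
    unfolding high_def by (rule cfc_tent_eq_0_if_bounded_below[OF a _ \<delta>(1,3)]) (simp add: m(2))
  moreover have "norm (cfc low a) \<le> r - \<delta>"
  proof (rule norm_cfc_le[OF a _ cont(2)])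
    fix t assume "\<bar>t - 0\<bar> \<le> norm a"
    then have "t\<^sup>2 \<le> r" using power_mono[of "\<bar>t\<bar>" "norm a" 2] by (simp add: r_def)
    moreover have "\<delta> * high t = max 0 (\<delta> - \<bar>t\<^sup>2 - r\<bar>)"
      using \<delta>(1) by (simp add: high_def tent_def max_mult_distrib_left power2_eq_square algebra_simps)
    ultimately show "\<bar>low t\<bar> \<le> r - \<delta>" using \<delta>(2) by (auto simp: low_def power2_eq_square)
  qed simp
  moreover have "a * a = cfc low a + \<delta> *\<^sub>R cfc high a"
  proof -
    have "a * a = cfc (poly [:0, 0, 1:]) a" by (simp only: cfc_poly[OF a]) simp
    also have "poly [:0, 0, 1:] = (\<lambda>t. low t + \<delta> * high t)" by (auto simp: low_def)
    finally show ?thesis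
      by (simp add: cfc_add cfc_mult cfc_const a cont continuous_on_mult_left)
  qed
  ultimately show False using \<delta>(1) norm_square_selfadjoint[OF a] by (simp add: r_def)
qed

lemma Mspec_square_diff:
  assumes a: "st a = a" shows "Mspec (a * a - r *\<^sub>R 1) = norm a ^ 2 - r"
proof -
  have shift: "l \<in> spec (b - r *\<^sub>R 1) \<longleftrightarrow> l + of_real r \<in> spec b" for l and b :: 'a
    by (simp add: spec_def scaleR_scaleC scaleC.add_left algebra_simps)
  have "of_real (norm a ^ 2 - r) \<in> spec (a * a - r *\<^sub>R 1)"
    using norm_square_in_spec[OF a] by (simp add: shift)
  then have "norm a ^ 2 - r \<in> Re ` spec (a * a - r *\<^sub>R 1)" by (force intro: rev_image_eqI)
  moreover have "Re l \<le> norm a ^ 2 - r" if "l \<in> spec (a * a - r *\<^sub>R 1)" for l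
  proof -
    have "cmod (l + of_real r) \<le> norm a ^ 2"
      using spec_norm_le that by (simp add: shift flip: norm_square_selfadjoint[OF a])
    then show ?thesis using complex_Re_le_cmod[of "l + of_real r"] by simp
  qed
  ultimately show ?thesis unfolding Mspec_def by (intro cSup_eq_maximum) auto
qed

end

section \<open>Uniform closures\<close>

lemma C0_continuous: "f \<in> C0 \<Longrightarrow> continuous_on UNIV f"
  by (simp add: C0_def)

lemma C0_vanishes: "f \<in> C0 \<Longrightarrow> e > 0 \<Longrightarrow> \<exists>K. compact K \<and> (\<forall>x. x \<notin> K \<longrightarrow> norm (f x) < e)"
  by (simp add: C0_def)

lemma compact_C0_superlevel:
  assumes "f \<in> C0" "e > 0" shows "compact {x. e \<le> norm (f x)}"
proof -
  obtain K where K: "compact K" "\<And>x. x \<notin> K \<Longrightarrow> norm (f x) < e"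
    using C0_vanishes[OF assms] by blast
  have "closed {x. e \<le> norm (f x)}"
    by (intro closed_Collect_le continuous_intros C0_continuous[OF assms(1)])
  then have "compact ({x. e \<le> norm (f x)} \<inter> K)" using K(1) by (rule closed_Int_compact)
  moreover have "{x. e \<le> norm (f x)} \<inter> K = {x. e \<le> norm (f x)}" using K(2) by force
  ultimately show ?thesis by simp
qed

lemma C0_bounded:
  assumes "f \<in> C0" shows "\<exists>B>0. \<forall>x. norm (f x) \<le> B"
proof -
  have "compact (f ` {x. 1 \<le> norm (f x)})"
    by (intro compact_continuous_image compact_C0_superlevel assms
        continuous_on_subset[OF C0_continuous[OF assms]]) auto
  then obtain B where "\<forall>x\<in>f ` {x. 1 \<le> norm (f x)}. norm x \<le> B"
    using compact_imp_bounded bounded_iff by metis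
  then have "norm (f x) \<le> max 1 B" for x by (cases "1 \<le> norm (f x)") (auto simp: le_max_iff_disj)
  then show ?thesis by (intro exI[of _ "max 1 B"]) auto
qed

lemma C0_norm: "f \<in> C0 \<Longrightarrow> (\<lambda>x. norm (f x)) \<in> C0"
  by (auto simp: C0_def intro: continuous_on_norm)

lemma C0_diff:
  assumes "f \<in> C0" "g \<in> C0" shows "(\<lambda>x. f x - g x) \<in> C0"
  unfolding C0_def
proof (intro CollectI conjI allI impI)
  show "continuous_on UNIV (\<lambda>x. f x - g x)"
    by (intro continuous_intros C0_continuous assms)
  fix e :: real assume "e > 0"
  then obtain K L where "compact K" "\<And>x. x \<notin> K \<Longrightarrow> norm (f x) < e/2"
    and "compact L" "\<And>x. x \<notin> L \<Longrightarrow> norm (g x) < e/2"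
    using C0_vanishes[OF assms(1), of "e/2"] C0_vanishes[OF assms(2), of "e/2"] by auto
  moreover have "norm (f x - g x) < e" if "norm (f x) < e/2" "norm (g x) < e/2" for x
    using that norm_triangle_ineq4[of "f x" "g x"] by simp
  ultimately show "\<exists>K. compact K \<and> (\<forall>x. x \<notin> K \<longrightarrow> norm (f x - g x) < e)"
    by (intro exI[of _ "K \<union> L"]) auto
qed

lemma C0_uniform_limit:
  assumes approx: "\<And>e. e > 0 \<Longrightarrow> \<exists>g\<in>C0. \<forall>x. norm (g x - f x) \<le> e"
  shows "f \<in> C0"
  unfolding C0_def
proof (intro CollectI conjI allI impI)
  have "\<exists>g\<in>C0. \<forall>x. norm (g x - f x) \<le> inverse (real (Suc n))" for n
    by (rule approx) simp
  then obtain g where g: "\<And>n. g n \<in> C0" "\<And>n x. norm (g n x - f x) \<le> inverse (real (Suc n))"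
    by metis
  have "uniform_limit UNIV g f sequentially"
  proof (rule uniform_limitI)
    fix e :: real assume "e > 0"
    have "\<forall>\<^sub>F n in sequentially. inverse (real (Suc n)) < e"
      using LIMSEQ_inverse_real_of_nat \<open>e > 0\<close> by (rule order_tendstoD)
    then show "\<forall>\<^sub>F n in sequentially. \<forall>x\<in>UNIV. dist (g n x) (f x) < e"
      by eventually_elim (use g(2) in \<open>auto simp: dist_norm intro: le_less_trans\<close>)
  qed
  then show "continuous_on UNIV f"
    by (rule uniform_limit_theorem[rotated]) (auto intro!: always_eventually C0_continuous g(1))
  fix e :: real assume "e > 0"
  then obtain g where g: "g \<in> C0" "\<And>x. norm (g x - f x) \<le> e/2" using approx[of "e/2"] by auto
  obtain K where K: "compact K" "\<And>x. x \<notin> K \<Longrightarrow> norm (g x) < e/2"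
    using C0_vanishes[OF g(1), of "e/2"] \<open>e > 0\<close> by auto
  have "norm (f x) < e" if "x \<notin> K" for x
    using K(2)[OF that] g(2)[of x] norm_triangle_ineq4[of "g x" "g x - f x"] by simp
  then show "\<exists>K. compact K \<and> (\<forall>x. x \<notin> K \<longrightarrow> norm (f x) < e)" using K(1) by blast
qed

lemma uniform_closureI:
  assumes E: "E \<subseteq> C0" and approx: "\<And>e. e > 0 \<Longrightarrow> \<exists>v\<in>E. \<forall>x. norm (v x - u x) \<le> e"
  shows "u \<in> uniform_closure E"
  unfolding uniform_closure_def
proof (intro CollectI conjI allI impI)
  show "u \<in> C0" using approx E by (intro C0_uniform_limit) blast
  fix e :: real assume "e > 0"
  then obtain v where v: "v \<in> E" "\<And>x. norm (v x - u x) \<le> e/2" using approx[of "e/2"] by auto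
  then have "(SUP x. norm (v x - u x)) \<le> e/2" by (intro cSUP_least) auto
  then show "\<exists>v\<in>E. (SUP x. norm (v x - u x)) < e"
    using v(1) \<open>e > 0\<close> by (intro bexI[of _ v]) auto
qed

lemma uniform_closure_approx:
  assumes E: "E \<subseteq> C0" and u: "u \<in> uniform_closure E" and "e > 0"
  shows "\<exists>v\<in>E. \<forall>x. norm (v x - u x) < e"
proof -
  obtain v where v: "v \<in> E" "(SUP x. norm (v x - u x)) < e"
    using u \<open>e > 0\<close> unfolding uniform_closure_def by blast
  have "(\<lambda>x. v x - u x) \<in> C0" using E u v(1) by (intro C0_diff) (auto simp: uniform_closure_def)
  then obtain B where "\<forall>x. norm (v x - u x) \<le> B" using C0_bounded by blast
  then have "bdd_above (range (\<lambda>x. norm (v x - u x)))" by (intro bdd_aboveI2[of _ _ B]) auto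
  then have "norm (v z - u z) \<le> (SUP x. norm (v x - u x))" for z by (intro cSUP_upper) auto
  then show ?thesis using v by (intro bexI[OF _ v(1)]) (blast intro: le_less_trans)
qed

lemma subset_uniform_closure:
  assumes "E \<subseteq> C0" shows "E \<subseteq> uniform_closure E"
proof
  fix u assume "u \<in> E"
  then show "u \<in> uniform_closure E" by (intro uniform_closureI[OF assms] bexI[of _ u]) auto
qed

lemma uniform_closure_idem_subset:
  assumes "E \<subseteq> C0" shows "uniform_closure (uniform_closure E) \<subseteq> uniform_closure E"
proof
  fix u assume u: "u \<in> uniform_closure (uniform_closure E)"
  show "u \<in> uniform_closure E"
  proof (rule uniform_closureI[OF assms])
    fix e :: real assume "e > 0"
    obtain v where v: "v \<in> uniform_closure E" "\<And>x. norm (v x - u x) < e/2"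
      using uniform_closure_approx[OF _ u, of "e/2"] \<open>e > 0\<close> by (auto simp: uniform_closure_def)
    obtain w where w: "w \<in> E" "\<And>x. norm (w x - v x) < e/2"
      using uniform_closure_approx[OF assms v(1), of "e/2"] \<open>e > 0\<close> by auto
    have "norm (w x - u x) \<le> e" for x
      using v(2)[of x] w(2)[of x] norm_triangle_ineq[of "w x - v x" "v x - u x"] by simp
    then show "\<exists>w\<in>E. \<forall>x. norm (w x - u x) \<le> e" using w(1) by blast
  qed
qed

lemma Delta2_mono: "E \<subseteq> F \<Longrightarrow> Delta2 E \<subseteq> Delta2 F"
  unfolding Delta2_def by blast

lemma uniform_closure_subset_Delta2:
  assumes "E \<subseteq> C0" shows "uniform_closure E \<subseteq> Delta2 E"
proof
  fix u assume u: "u \<in> uniform_closure E"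
  show "u \<in> Delta2 E" unfolding Delta2_def
  proof (intro CollectI conjI allI impI)
    show "u \<in> C0" using u by (simp add: uniform_closure_def)
    show "\<exists>v\<in>E. norm (v x - u x) < e \<and> norm (v y - u y) < e" if "e > 0" for x y e
      using uniform_closure_approx[OF assms u that] by blast
  qed
qed

lemma
  assumes "star_subalgebra st E"
  shows star_subalgebra_subset_C0: "E \<subseteq> C0"
    and star_subalgebra_zero: "(\<lambda>_. 0) \<in> E"
    and star_subalgebra_add: "f \<in> E \<Longrightarrow> g \<in> E \<Longrightarrow> (\<lambda>x. f x + g x) \<in> E"
    and star_subalgebra_mult: "f \<in> E \<Longrightarrow> g \<in> E \<Longrightarrow> (\<lambda>x. f x * g x) \<in> E"
    and star_subalgebra_scaleC: "f \<in> E \<Longrightarrow> (\<lambda>x. c *\<^sub>C f x) \<in> E"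
    and star_subalgebra_star: "f \<in> E \<Longrightarrow> (\<lambda>x. st (f x)) \<in> E"
  using assms by (auto simp: star_subalgebra_def)

lemma uniform_closure_mult:
  fixes E :: "('x::topological_space \<Rightarrow> 'a::real_normed_algebra) set"
  assumes E: "E \<subseteq> C0" and mult: "\<And>f g. f \<in> E \<Longrightarrow> g \<in> E \<Longrightarrow> (\<lambda>x. f x * g x) \<in> E"
    and f: "f \<in> uniform_closure E" and g: "g \<in> uniform_closure E"
  shows "(\<lambda>x. f x * g x) \<in> uniform_closure E"
proof (rule uniform_closureI[OF E])
  fix e :: real assume "e > 0"
  have "f \<in> C0" "g \<in> C0" using f g by (simp_all add: uniform_closure_def)
  then obtain B C where B: "B > 0" "\<And>x. norm (f x) \<le> B" and C: "C > 0" "\<And>x. norm (g x) \<le> C"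
    using C0_bounded[of f] C0_bounded[of g] by blast
  define d where "d = min 1 (e / (B + C + 1))"
  have d: "d > 0" "d \<le> 1" using \<open>e > 0\<close> B(1) C(1) by (auto simp: d_def)
  have "d \<le> e / (B + C + 1)" by (simp add: d_def)
  then have d_le: "d * (B + C + 1) \<le> e" using B(1) C(1) by (simp add: pos_le_divide_eq)
  obtain v where v: "v \<in> E" "\<And>x. norm (v x - f x) < d"
    using uniform_closure_approx[OF E f d(1)] by blast
  obtain w where w: "w \<in> E" "\<And>x. norm (w x - g x) < d"
    using uniform_closure_approx[OF E g d(1)] by blast
  have "norm (v x * w x - f x * g x) \<le> e" for x
  proof -
    have "norm (w x) \<le> C + 1"
      using norm_triangle_ineq[of "g x" "w x - g x"] C(2)[of x] w(2)[of x] d(2) by simp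
    have "norm (v x * w x - f x * g x) = norm ((v x - f x) * w x + f x * (w x - g x))"
      by (simp add: algebra_simps)
    also have "\<dots> \<le> norm (v x - f x) * norm (w x) + norm (f x) * norm (w x - g x)"
      by (intro norm_triangle_le add_mono norm_mult_ineq)
    also have "\<dots> \<le> d * (C + 1) + B * d"
      using v(2)[of x] w(2)[of x] B C(1) \<open>norm (w x) \<le> C + 1\<close> d(1)
      by (intro add_mono mult_mono) (auto intro: less_imp_le)
    also have "\<dots> \<le> e" using d_le by (simp add: algebra_simps)
    finally show ?thesis .
  qed
  then show "\<exists>v\<in>E. \<forall>x. norm (v x - f x * g x) \<le> e"
    by (intro bexI[OF _ mult[OF v(1) w(1)]]) simp
qed

lemma uniform_closure_add:
  fixes E :: "('x::topological_space \<Rightarrow> 'a::real_normed_vector) set"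
  assumes E: "E \<subseteq> C0" and add: "\<And>f g. f \<in> E \<Longrightarrow> g \<in> E \<Longrightarrow> (\<lambda>x. f x + g x) \<in> E"
    and f: "f \<in> uniform_closure E" and g: "g \<in> uniform_closure E"
  shows "(\<lambda>x. f x + g x) \<in> uniform_closure E"
proof (rule uniform_closureI[OF E])
  fix e :: real assume "e > 0"
  then have "e / 2 > 0" by simp
  obtain v where v: "v \<in> E" "\<And>x. norm (v x - f x) < e/2"
    using uniform_closure_approx[OF E f \<open>e / 2 > 0\<close>] by blast
  obtain w where w: "w \<in> E" "\<And>x. norm (w x - g x) < e/2"
    using uniform_closure_approx[OF E g \<open>e / 2 > 0\<close>] by blast
  have "norm (v x + w x - (f x + g x)) \<le> e" for x
    using norm_diff_triangle_ineq[of "v x" "w x" "f x" "g x"] v(2)[of x] w(2)[of x] by linarith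
  then show "\<exists>v\<in>E. \<forall>x. norm (v x - (f x + g x)) \<le> e"
    by (intro bexI[OF _ add[OF v(1) w(1)]]) simp
qed

lemma uniform_closure_bounded_linear:
  assumes E: "E \<subseteq> C0" and L: "bounded_linear L" and L_mem: "\<And>f. f \<in> E \<Longrightarrow> (\<lambda>x. L (f x)) \<in> E"
    and f: "f \<in> uniform_closure E"
  shows "(\<lambda>x. L (f x)) \<in> uniform_closure E"
proof (rule uniform_closureI[OF E])
  fix e :: real assume "e > 0"
  obtain K where K: "K > 0" "\<And>a. norm (L a) \<le> norm a * K"
    using bounded_linear.pos_bounded[OF L] by blast
  obtain v where v: "v \<in> E" "\<And>x. norm (v x - f x) < e / K"
    using uniform_closure_approx[OF E f, of "e / K"] \<open>e > 0\<close> K(1) by auto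
  have "norm (L (v x) - L (f x)) \<le> e" for x
  proof -
    have "norm (L (v x) - L (f x)) \<le> norm (v x - f x) * K"
      using K(2) by (simp flip: linear_diff[OF bounded_linear.linear[OF L]])
    also have "\<dots> \<le> e" using v(2)[of x] K(1) by (simp add: pos_less_divide_eq less_imp_le)
    finally show ?thesis .
  qed
  then show "\<exists>v\<in>E. \<forall>x. norm (v x - L (f x)) \<le> e"
    by (intro bexI[OF _ L_mem[OF v(1)]]) simp
qed

lemma (in cstar_algebra) star_subalgebra_uniform_closure:
  assumes E: "star_subalgebra st E" shows "star_subalgebra st (uniform_closure E)"
  unfolding star_subalgebra_def
proof (intro conjI ballI allI)
  note C0 = star_subalgebra_subset_C0[OF E]
  show "uniform_closure E \<subseteq> C0" by (auto simp: uniform_closure_def)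
  show "(\<lambda>_. 0) \<in> uniform_closure E"
    using star_subalgebra_zero[OF E] subset_uniform_closure[OF C0] by blast
  fix f assume f: "f \<in> uniform_closure E"
  show "(\<lambda>x. c *\<^sub>C f x) \<in> uniform_closure E" for c
    by (rule uniform_closure_bounded_linear[OF C0
        scaleC.bounded_linear_right star_subalgebra_scaleC[OF E] f])
  show "(\<lambda>x. st (f x)) \<in> uniform_closure E"
    by (rule uniform_closure_bounded_linear[OF C0 bounded_linear_st star_subalgebra_star[OF E] f])
  fix g assume g: "g \<in> uniform_closure E"
  show "(\<lambda>x. f x + g x) \<in> uniform_closure E"
    by (rule uniform_closure_add[OF C0 star_subalgebra_add[OF E] f g])
  show "(\<lambda>x. f x * g x) \<in> uniform_closure E"
    by (rule uniform_closure_mult[OF C0 star_subalgebra_mult[OF E] f g])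
qed

section \<open>Normal elements with disjoint spectra\<close>

definition unit_clamp :: "real \<Rightarrow> real" where
  "unit_clamp t = max 0 (min 1 t)"

lemma unit_clamp_eq_0: "t \<le> 0 \<Longrightarrow> unit_clamp t = 0"
  and unit_clamp_eq_1: "1 \<le> t \<Longrightarrow> unit_clamp t = 1"
  by (auto simp: unit_clamp_def)

lemma sum_tent:
  assumes "\<delta> > 0" "\<bar>t\<bar> \<le> R" "2 * R \<le> real n * \<delta>"
  shows "(\<Sum>k<Suc n. tent \<delta> (real k * \<delta> - R) t) = 1"
proof -
  define s where "s = (t + R) / \<delta>"
  have s: "0 \<le> s" "s \<le> real n"
    using assms by (auto simp: s_def divide_le_eq abs_le_iff)
  define clamped where "clamped k = unit_clamp (s + 1 - real k)" for k
  have "tent \<delta> (real k * \<delta> - R) t = clamped k - clamped (Suc k)" for k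
  proof -
    have "(t - (real k * \<delta> - R)) / \<delta> = s - real k"
      using assms(1) by (simp add: s_def field_simps)
    then have "\<bar>t - (real k * \<delta> - R)\<bar> / \<delta> = \<bar>s - real k\<bar>"
      using assms(1) by (metis abs_divide abs_of_pos)
    then show ?thesis by (auto simp: tent_def clamped_def unit_clamp_def)
  qed
  then have "(\<Sum>k<Suc n. tent \<delta> (real k * \<delta> - R) t) = clamped 0 - clamped (Suc n)"
    by (simp only: sum_lessThan_telescope')
  also have "\<dots> = 1" using s by (simp add: clamped_def unit_clamp_def)
  finally show ?thesis .
qed

lemma bounded_below_diff_scaleC:
  fixes a :: "'a::complex_banach_algebra_1"
  assumes "bounded_below m (a - l *\<^sub>C 1)"
  shows "bounded_below (m - cmod (l - l')) (a - l' *\<^sub>C 1)"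
  using bounded_below_add[OF assms, of "(l - l') *\<^sub>C 1"]
  unfolding norm_scaleC norm_one mult_1_right by (simp add: scaleC.diff_left)

lemma bounded_below_diff_large_scaleC:
  fixes a :: "'a::complex_banach_algebra_1"
  shows "bounded_below (cmod l - norm a) (a - l *\<^sub>C 1)"
proof -
  have "bounded_below (cmod l) (- (l *\<^sub>C (1::'a)))"
    by (simp add: bounded_below_def norm_scaleC mult_scaleC_left)
  from bounded_below_add[OF this, of a] show ?thesis by simp
qed

lemma compact_induct:
  assumes "compact K" and empty: "P {}" and mono: "\<And>A B. P B \<Longrightarrow> A \<subseteq> B \<Longrightarrow> P A"
    and local: "\<And>x. x \<in> K \<Longrightarrow> \<exists>U. open U \<and> x \<in> U \<and> (\<forall>A. P A \<longrightarrow> P (A \<union> U))"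
  shows "P K"
proof -
  obtain U where U: "\<And>x. x \<in> K \<Longrightarrow> open (U x) \<and> x \<in> U x \<and> (\<forall>A. P A \<longrightarrow> P (A \<union> U x))"
    using local by metis
  obtain F where F: "F \<subseteq> K" "finite F" "K \<subseteq> (\<Union>x\<in>F. U x)"
    by (rule compactE_image[OF assms(1), of K U]) (use U in auto)
  have "P (\<Union>x\<in>F. U x)"
    using F(2,1)
  proof (induction F rule: finite_induct)
    case (insert x F)
    then have "P ((\<Union>x\<in>F. U x) \<union> U x)" using U[of x] by simp
    then show ?case by (simp add: Un_commute)
  qed (simp add: empty)
  then show ?thesis using mono F(3) by blast
qed

lemma disjoint_spectra_locally_bounded_below:
  fixes a b :: "'a::complex_banach_algebra_1"
  assumes "spec a \<inter> spec b = {}"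
  shows "\<exists>r>0. \<forall>l'\<in>ball l r. bounded_below r (a - l' *\<^sub>C 1) \<or> bounded_below r (b - l' *\<^sub>C 1)"
proof -
  have "invertible_el (a - l *\<^sub>C 1) \<or> invertible_el (b - l *\<^sub>C 1)"
    using assms by (auto simp: spec_def)
  then obtain m where m: "m > 0" "bounded_below m (a - l *\<^sub>C 1) \<or> bounded_below m (b - l *\<^sub>C 1)"
    using invertible_el_imp_bounded_below by metis
  have "bounded_below (m / 2) (c - l' *\<^sub>C 1)"
    if "l' \<in> ball l (m / 2)" "bounded_below m (c - l *\<^sub>C 1)" for c :: 'a and l'
    by (rule bounded_below_mono[OF bounded_below_diff_scaleC[OF that(2)]])
        (use that(1) in \<open>simp add: dist_norm\<close>)
  then show ?thesis using m by (intro exI[of _ "m / 2"]) auto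
qed

lemma disjoint_spectra_bounded_below:
  fixes a b :: "'a::complex_banach_algebra_1"
  assumes disjoint: "spec a \<inter> spec b = {}"
  obtains m where "m > 0" "\<And>l. bounded_below m (a - l *\<^sub>C 1) \<or> bounded_below m (b - l *\<^sub>C 1)"
proof -
  define below where "below m l \<longleftrightarrow> bounded_below m (a - l *\<^sub>C 1) \<or> bounded_below m (b - l *\<^sub>C 1)" for m l
  have below_mono: "below m' l" if "below m l" "m' \<le> m" for m m' l
    using that bounded_below_mono unfolding below_def by blast
  have "\<exists>m>0. \<forall>l\<in>cball 0 (norm a + 1). below m l"
  proof (rule compact_induct[OF compact_cball])
    show "\<exists>m>0. \<forall>l\<in>{}. below m l" by (intro exI[of _ 1]) simp
    show "\<exists>m>0. \<forall>l\<in>A. below m l" if "\<exists>m>0. \<forall>l\<in>B. below m l" "A \<subseteq> B" for A B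
      using that by blast
    fix l
    obtain r where r: "r > 0" "\<forall>l'\<in>ball l r. below r l'"
      using disjoint_spectra_locally_bounded_below[OF disjoint] unfolding below_def by blast
    have "\<exists>m>0. \<forall>l'\<in>A \<union> ball l r. below m l'" if A: "\<exists>m>0. \<forall>l'\<in>A. below m l'" for A
    proof -
      obtain m where m: "m > 0" "\<forall>l'\<in>A. below m l'" using A by blast
      have "below (min m r) l'" if "l' \<in> A \<union> ball l r" for l'
        using that r(2) m(2) below_mono by (meson UnE min.cobounded1 min.cobounded2)
      then show ?thesis using m(1) r(1) by (intro exI[of _ "min m r"]) simp
    qed
    then show "\<exists>U. open U \<and> l \<in> U \<and>
        (\<forall>A. (\<exists>m>0. \<forall>l\<in>A. below m l) \<longrightarrow> (\<exists>m>0. \<forall>l\<in>A \<union> U. below m l))"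
      using r(1) by (intro exI[of _ "ball l r"]) simp
  qed
  then obtain m where m: "m > 0" "\<And>l. cmod l \<le> norm a + 1 \<Longrightarrow> below m l" by auto
  have "below (min m 1) l" for l
  proof (cases "cmod l \<le> norm a + 1")
    case True
    then show ?thesis by (intro below_mono[OF m(2)]) simp_all
  next
    case False
    have "below (cmod l - norm a) l" by (simp add: below_def bounded_below_diff_large_scaleC)
    then show ?thesis by (rule below_mono) (use False in simp)
  qed
  then show ?thesis using that[of "min m 1"] m(1) by (simp add: below_def)
qed

context cstar_algebra
begin

definition real_part :: "'a \<Rightarrow> 'a" where
  "real_part a = (1/2) *\<^sub>R (a + st a)"

definition imag_part :: "'a \<Rightarrow> 'a" where
  "imag_part a = (- \<i> / 2) *\<^sub>C (a - st a)"

lemma st_real_part [simp]: "st (real_part a) = real_part a"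
  by (simp add: real_part_def st_scaleR st_add add.commute)

lemma st_imag_part [simp]: "st (imag_part a) = imag_part a"
  by (simp add: imag_part_def st_scaleC st_diff scaleC.diff_right scaleC.minus_left)

lemma real_part_plus_imag_part: "real_part a + \<i> *\<^sub>C imag_part a = a"
proof -
  have "\<i> *\<^sub>C imag_part a = (1/2) *\<^sub>R (a - st a)"
    by (simp add: imag_part_def scaleC_scaleC scaleR_scaleC)
  then show ?thesis by (simp add: real_part_def scaleR_half_double flip: scaleR_add_right)
qed

lemma norm_real_part_le: "norm (real_part a) \<le> norm a"
  using norm_triangle_ineq[of a "st a"] by (simp add: real_part_def)

lemma norm_imag_part_le: "norm (imag_part a) \<le> norm a"
  using norm_triangle_ineq4[of a "st a"] by (simp add: imag_part_def norm_scaleC norm_divide)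

lemma real_part_diff: "real_part (a - b) = real_part a - real_part b"
  by (simp add: real_part_def st_diff algebra_simps)

lemma real_part_one [simp]: "real_part 1 = 1"
  unfolding real_part_def st_one by (rule scaleR_half_double)

lemma normal_parts_commute:
  assumes "normal_el st a" shows "real_part a * imag_part a = imag_part a * real_part a"
proof -
  have "(a + st a) * (a - st a) = (a - st a) * (a + st a)"
    using assms by (simp add: normal_el_def algebra_simps)
  then show ?thesis
    by (simp add: real_part_def imag_part_def scaleR_scaleC mult_scaleC_left mult_scaleC_right
        scaleC_scaleC mult.commute)
qed

definition cell :: "real \<Rightarrow> real \<Rightarrow> real \<Rightarrow> 'a \<Rightarrow> 'a" where
  "cell \<delta> s t a = cfc (tent \<delta> s) (real_part a) * cfc (tent \<delta> t) (imag_part a)"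

lemma cell_eq_0_if_bounded_below:
  assumes normal: "normal_el st a" and below: "bounded_below m (a - Complex s t *\<^sub>C 1)"
    and \<delta>: "\<delta> > 0" "2 * \<delta> < m"
  shows "cell \<delta> s t a = 0"
proof (rule ccontr)
  define F where "F = cfc (tent \<delta> s) (real_part a)"
  define G where "G = cfc (tent \<delta> t) (imag_part a)"
  have "imag_part a * F = F * imag_part a" unfolding F_def
    by (intro cfc_commute continuous_on_tent) (simp_all add: normal_parts_commute[OF normal])
  then have FG: "F * G = G * F" unfolding G_def
    by (intro cfc_commute continuous_on_tent) simp_all
  have part_le: "norm ((b - c *\<^sub>R 1) * (cfc (tent \<delta> c) b * y)) \<le> \<delta> * norm (cfc (tent \<delta> c) b * y)"
    if "st b = b" for b c y
    using norm_cfc_mult_le_on_support[OF that continuous_on_tent[of \<delta> c], of "poly [:- c, 1:]" \<delta> y]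
      tent_support[OF \<delta>(1)] \<delta>(1)
    by (simp add: cfc_poly[OF that] continuous_on_poly del: poly_pCons) (simp add: abs_minus_commute)
  assume "cell \<delta> s t a \<noteq> 0"
  then have "2 * \<delta> * norm (F * G) < m * norm (F * G)" using \<delta>(2) by (simp add: cell_def F_def G_def)
  also have "\<dots> \<le> norm ((a - Complex s t *\<^sub>C 1) * (F * G))" using below by (simp add: bounded_below_def)
  also have "a - Complex s t *\<^sub>C 1 = (real_part a - s *\<^sub>R 1) + \<i> *\<^sub>C (imag_part a - t *\<^sub>R 1)"
    by (subst real_part_plus_imag_part[of a, symmetric])
      (simp add: complex_eq_iff Complex_eq scaleC.diff_right scaleC.add_left scaleC_scaleC scaleR_scaleC)
  also have "\<dots> * (F * G) = (real_part a - s *\<^sub>R 1) * (F * G) + \<i> *\<^sub>C ((imag_part a - t *\<^sub>R 1) * (G * F))"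
    by (simp only: FG distrib_right mult_scaleC_left)
  also have "norm \<dots> \<le> norm ((real_part a - s *\<^sub>R 1) * (F * G)) + norm ((imag_part a - t *\<^sub>R 1) * (G * F))"
    by (rule order_trans[OF norm_triangle_ineq]) (simp add: norm_scaleC)
  also have "\<dots> \<le> \<delta> * norm (F * G) + \<delta> * norm (G * F)"
    unfolding F_def G_def by (intro add_mono part_le) simp_all
  finally show False by (simp add: FG)
qed

lemma sum_cells:
  assumes \<delta>: "\<delta> > 0" "2 * R \<le> real n * \<delta>" and R: "norm a \<le> R"
  shows "(\<Sum>(i, j)\<in>{..<Suc n} \<times> {..<Suc n}. cell \<delta> (real i * \<delta> - R) (real j * \<delta> - R) a) = 1"
proof -
  have sum_eq_1: "(\<Sum>k<Suc n. cfc (tent \<delta> (real k * \<delta> - R)) b) = 1" if "st b = b" "norm b \<le> R" for b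
  proof -
    have "(\<Sum>k<Suc n. cfc (tent \<delta> (real k * \<delta> - R)) b) = cfc (\<lambda>t. \<Sum>k<Suc n. tent \<delta> (real k * \<delta> - R) t) b"
      by (rule cfc_sum[symmetric, OF that(1) continuous_on_tent])
    also have "\<dots> = 1 *\<^sub>R 1"
      by (rule cfc_eq_const[of b 0 R])
        (use that sum_tent[OF \<delta>(1) _ \<delta>(2)] in
          \<open>simp_all add: continuous_on_sum continuous_on_tent del: sum.lessThan_Suc\<close>)
    finally show ?thesis by simp
  qed
  have "(\<Sum>(i, j)\<in>{..<Suc n} \<times> {..<Suc n}. cell \<delta> (real i * \<delta> - R) (real j * \<delta> - R) a)
      = (\<Sum>i<Suc n. cfc (tent \<delta> (real i * \<delta> - R)) (real_part a))
        * (\<Sum>j<Suc n. cfc (tent \<delta> (real j * \<delta> - R)) (imag_part a))"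
    by (simp only: cell_def sum_product sum.cartesian_product)
  also have "\<dots> = 1"
    using R norm_real_part_le[of a] norm_imag_part_le[of a] by (simp del: sum.lessThan_Suc add: sum_eq_1)
  finally show ?thesis .
qed

end

section \<open>Norm-equivalent points\<close>

definition norm_equiv :: "('x \<Rightarrow> 'a::complex_banach_algebra_1) set \<Rightarrow> 'x \<Rightarrow> 'x \<Rightarrow> bool" where
  "norm_equiv E x y \<longleftrightarrow> (\<forall>f\<in>E. \<forall>c. norm (f x + c *\<^sub>C 1) = norm (f y + c *\<^sub>C 1))"

lemma norm_equivD: "norm_equiv E x y \<Longrightarrow> f \<in> E \<Longrightarrow> norm (f x) = norm (f y)"
  unfolding norm_equiv_def by (metis add.right_neutral scaleC.zero_left)

lemma norm_equiv_sym: "norm_equiv E x y \<Longrightarrow> norm_equiv E y x"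
  by (simp add: norm_equiv_def)

lemma norm_equiv_uniform_closure:
  assumes E: "E \<subseteq> C0" and xy: "norm_equiv E x y" shows "norm_equiv (uniform_closure E) x y"
proof -
  have norm_le: "norm (f x + c *\<^sub>C 1) \<le> norm (f y + c *\<^sub>C 1)"
    if f: "f \<in> uniform_closure E" and xy: "norm_equiv E x y" for f c x y
  proof (rule field_le_epsilon)
    fix e :: real assume "e > 0"
    then obtain v where v: "v \<in> E" "\<And>z. norm (v z - f z) < e/2"
      using uniform_closure_approx[OF E f, of "e/2"] by auto
    have "norm (f x + c *\<^sub>C 1) \<le> norm (v x + c *\<^sub>C 1) + e/2"
      using norm_triangle_ineq4[of "v x + c *\<^sub>C 1" "v x - f x"] v(2)[of x] by (simp add: add.commute)
    also have "norm (v x + c *\<^sub>C 1) = norm (v y + c *\<^sub>C 1)" using xy v(1) by (simp add: norm_equiv_def)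
    also have "\<dots> \<le> norm (f y + c *\<^sub>C 1) + e/2"
      using norm_triangle_ineq[of "f y + c *\<^sub>C 1" "v y - f y"] v(2)[of y] by (simp add: algebra_simps)
    finally show "norm (f x + c *\<^sub>C 1) \<le> norm (f y + c *\<^sub>C 1) + e" by simp
  qed
  show ?thesis
    unfolding norm_equiv_def
    using norm_le[OF _ xy] norm_le[OF _ norm_equiv_sym[OF xy]] by (auto intro: order_antisym)
qed

text \<open>With \<open>b = f + c\<close> and \<open>g = b\<^sup>* b - \<bar>c\<bar>\<^sup>2\<close>, the function \<open>(b\<^sup>* b)\<^sup>2 - \<bar>c\<bar>\<^sup>4 = g\<^sup>2 + 2 \<bar>c\<bar>\<^sup>2 g\<close> lies in \<open>E\<close>
  and has maximal spectral value \<open>norm b ^ 4 - \<bar>c\<bar>\<^sup>4\<close>.\<close>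

lemma (in cstar_algebra) Mspec_eq_imp_norm_equiv:
  assumes E: "star_subalgebra st E"
    and M: "\<forall>f\<in>E. (\<forall>t. st (f t) = f t) \<longrightarrow> Mspec (f x) = Mspec (f y)"
  shows "norm_equiv E x y"
  unfolding norm_equiv_def
proof (intro ballI allI)
  fix f c assume f: "f \<in> E"
  note E_ops = star_subalgebra_add[OF E] star_subalgebra_mult[OF E] star_subalgebra_scaleC[OF E]
    star_subalgebra_star[OF E]
  define b where "b t = f t + c *\<^sub>C 1" for t
  define g where "g t = st (f t) * f t + (c *\<^sub>C st (f t) + cnj c *\<^sub>C f t)" for t
  have "g \<in> E" unfolding g_def by (intro E_ops f)
  define r where "r = cmod c ^ 2"
  have square_b: "st (b t) * b t = g t + r *\<^sub>R 1" for t
  proof -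
    have "st (b t) * b t = g t + (c * cnj c) *\<^sub>C 1"
      by (simp add: b_def g_def st_add st_scaleC algebra_simps mult_scaleC_left mult_scaleC_right
          scaleC_scaleC scaleC.add_right)
    then show ?thesis by (simp only: r_def scaleR_scaleC complex_norm_square)
  qed
  define h where "h t = g t * g t + (r *\<^sub>R g t + r *\<^sub>R g t)" for t
  have "h \<in> E" unfolding h_def scaleR_scaleC by (intro E_ops \<open>g \<in> E\<close>)
  have h_eq: "h t = (st (b t) * b t) * (st (b t) * b t) - r ^ 2 *\<^sub>R 1" for t
    unfolding square_b h_def by (simp add: algebra_simps power2_eq_square)
  have selfadjoint: "st (st (b t) * b t) = st (b t) * b t" for t by (simp add: st_mult)
  have "st (h t) = h t" for t by (simp add: h_eq st_diff st_mult st_scaleR)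
  then have "Mspec (h x) = Mspec (h y)" using M \<open>h \<in> E\<close> by blast
  then have "norm (b x) ^ 4 = norm (b y) ^ 4"
    unfolding h_eq Mspec_square_diff[OF selfadjoint] by (simp add: norm_st_mult flip: power_mult)
  then show "norm (f x + c *\<^sub>C 1) = norm (f y + c *\<^sub>C 1)"
    unfolding b_def by (rule power_eq_imp_eq_base) simp_all
qed

section \<open>Uniformly closed function algebras\<close>

definition right_multipliers :: "('x \<Rightarrow> 'a::times) set \<Rightarrow> ('x \<Rightarrow> 'a) set" where
  "right_multipliers E = {g. \<forall>f\<in>E. (\<lambda>x. f x * g x) \<in> E}"

lemma right_multipliers_mult:
  fixes E :: "('x \<Rightarrow> 'a::semigroup_mult) set"
  assumes "g \<in> right_multipliers E" "h \<in> right_multipliers E"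
  shows "(\<lambda>x. g x * h x) \<in> right_multipliers E"
  unfolding right_multipliers_def
proof (intro CollectI ballI)
  fix f assume "f \<in> E"
  then have "(\<lambda>x. f x * g x * h x) \<in> E" using assms by (simp add: right_multipliers_def)
  then show "(\<lambda>x. f x * (g x * h x)) \<in> E" by (simp add: mult.assoc)
qed

locale closed_function_algebra = cstar_algebra st
  for st :: "'a::complex_banach_algebra_1 \<Rightarrow> 'a" +
  fixes E :: "('x::topological_space \<Rightarrow> 'a) set"
  assumes subalgebra: "star_subalgebra st E" and uniformly_closed: "uniform_closure E \<subseteq> E"
begin

lemmas subset_C0 = star_subalgebra_subset_C0[OF subalgebra]
  and zero_mem = star_subalgebra_zero[OF subalgebra]
  and add_mem = star_subalgebra_add[OF subalgebra]
  and mult_mem = star_subalgebra_mult[OF subalgebra]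
  and scaleC_mem = star_subalgebra_scaleC[OF subalgebra]
  and star_mem = star_subalgebra_star[OF subalgebra]

lemma scaleR_mem: "f \<in> E \<Longrightarrow> (\<lambda>x. r *\<^sub>R f x) \<in> E"
  using scaleC_mem by (simp add: scaleR_scaleC)

lemma diff_mem: "f \<in> E \<Longrightarrow> g \<in> E \<Longrightarrow> (\<lambda>x. f x - g x) \<in> E"
  using add_mem[OF _ scaleC_mem[of g "-1"], of f] by (simp add: scaleC_minus_one)

lemma sum_mem: "(\<And>i. i \<in> I \<Longrightarrow> f i \<in> E) \<Longrightarrow> (\<lambda>x. \<Sum>i\<in>I. f i x) \<in> E"
  by (induction I rule: infinite_finite_induct) (auto intro: zero_mem add_mem)

lemma continuous_on_mem: "f \<in> E \<Longrightarrow> continuous_on UNIV f"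
  using subset_C0 C0_continuous by blast

lemma uniform_limit_mem: "(\<And>e. e > 0 \<Longrightarrow> \<exists>v\<in>E. \<forall>x. norm (v x - u x) \<le> e) \<Longrightarrow> u \<in> E"
  using uniformly_closed uniform_closureI[OF subset_C0] by blast

lemma poly_alg_mem:
  assumes f: "f \<in> E" shows "(\<lambda>x. poly_alg (pCons 0 p) (f x)) \<in> E"
proof (induction p)
  case (pCons c p)
  have "(\<lambda>x. c *\<^sub>R f x + f x * poly_alg (pCons 0 p) (f x)) \<in> E"
    by (intro add_mem scaleR_mem mult_mem f pCons.IH)
  then show ?case by (simp add: distrib_left)
qed (simp add: zero_mem)

lemma cfc_mem:
  assumes h: "h \<in> E" "\<And>x. st (h x) = h x" and \<theta>: "continuous_on UNIV \<theta>" "\<theta> 0 = 0"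
  shows "(\<lambda>x. cfc \<theta> (h x)) \<in> E"
proof (rule uniform_limit_mem)
  fix e :: real assume "e > 0"
  obtain B where B: "B > 0" "\<And>x. norm (h x) \<le> B" using C0_bounded subset_C0 h(1) by blast
  obtain P where "uniform_limit (cball 0 B) (\<lambda>n. poly (P n)) \<theta> sequentially"
    by (rule uniform_limit_real_polys[OF \<theta>(1)])
  from eventually_happens'[OF _ uniform_limitD[OF this, of "e / 2"]] \<open>e > 0\<close>
  obtain p where "\<forall>t\<in>cball 0 B. dist (poly p t) (\<theta> t) < e / 2" by auto
  then have p: "\<bar>poly p t - \<theta> t\<bar> < e / 2" if "\<bar>t\<bar> \<le> B" for t
    using that by (simp add: dist_real_def)
  obtain c q where q: "p = pCons c q" by (rule pCons_cases)
  have "\<bar>c\<bar> < e / 2" using p[of 0] B(1) \<theta>(2) by (simp add: q)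
  have "norm (poly_alg (pCons 0 q) (h x) - cfc \<theta> (h x)) \<le> e" for x
  proof (rule norm_poly_alg_diff_cfc_le[OF h(2) \<theta>(1) B(2)])
    fix t assume "\<bar>t\<bar> \<le> B"
    from p[OF this] \<open>\<bar>c\<bar> < e / 2\<close> show "\<bar>poly (pCons 0 q) t - \<theta> t\<bar> \<le> e"
      unfolding q poly_pCons by linarith
  qed
  then show "\<exists>v\<in>E. \<forall>x. norm (v x - cfc \<theta> (h x)) \<le> e"
    by (intro bexI[OF _ poly_alg_mem[OF h(1), of q]]) simp
qed

lemma real_part_mem: "f \<in> E \<Longrightarrow> (\<lambda>x. real_part (f x)) \<in> E"
  unfolding real_part_def by (intro scaleR_mem add_mem star_mem)

lemma imag_part_mem: "f \<in> E \<Longrightarrow> (\<lambda>x. imag_part (f x)) \<in> E"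
  unfolding imag_part_def by (intro scaleC_mem diff_mem star_mem)

lemma right_multipliers_cfc:
  assumes h: "h \<in> E" "\<And>x. st (h x) = h x" and \<phi>: "continuous_on UNIV \<phi>"
  shows "(\<lambda>x. cfc \<phi> (h x)) \<in> right_multipliers E"
  unfolding right_multipliers_def
proof (intro CollectI ballI)
  fix f assume f: "f \<in> E"
  have "cfc (\<lambda>t. \<phi> t - \<phi> 0 + \<phi> 0) (h x) = cfc (\<lambda>t. \<phi> t - \<phi> 0) (h x) + \<phi> 0 *\<^sub>R 1" for x
    by (subst cfc_add) (auto simp: h(2) cfc_const intro!: continuous_intros \<phi>)
  then have "f x * cfc \<phi> (h x) = f x * cfc (\<lambda>t. \<phi> t - \<phi> 0) (h x) + \<phi> 0 *\<^sub>R f x" for x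
    by (simp add: distrib_left)
  moreover have "(\<lambda>x. f x * cfc (\<lambda>t. \<phi> t - \<phi> 0) (h x) + \<phi> 0 *\<^sub>R f x) \<in> E"
    by (intro add_mem mult_mem scaleR_mem cfc_mem f h continuous_intros \<phi>) simp
  ultimately show "(\<lambda>x. f x * cfc \<phi> (h x)) \<in> E" by simp
qed

lemma right_multipliers_sum:
  "(\<And>i. i \<in> I \<Longrightarrow> g i \<in> right_multipliers E) \<Longrightarrow> (\<lambda>x. \<Sum>i\<in>I. g i x) \<in> right_multipliers E"
  by (auto simp: right_multipliers_def sum_distrib_left intro!: sum_mem)

lemma right_multipliers_cell: "f \<in> E \<Longrightarrow> (\<lambda>x. cell \<delta> s t (f x)) \<in> right_multipliers E"
  unfolding cell_def
  by (intro right_multipliers_mult right_multipliers_cfc real_part_mem imag_part_mem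
      continuous_on_tent) simp_all

text \<open>A cell of a fine enough partition of unity of the plane meets at most one of the two spectra.
  Add up those cells that vanish on \<open>f y\<close>.\<close>

lemma right_multiplier_separates:
  assumes f: "f \<in> E" "normal_el st (f x)" "normal_el st (f y)" and disj: "spec (f x) \<inter> spec (f y) = {}"
  shows "\<exists>g\<in>right_multipliers E. g x = 1 \<and> g y = 0"
proof -
  obtain m where m: "m > 0" "\<And>l. bounded_below m (f x - l *\<^sub>C 1) \<or> bounded_below m (f y - l *\<^sub>C 1)"
    using disjoint_spectra_bounded_below[OF disj] by blast
  define \<delta> where "\<delta> = m / 3"
  have \<delta>: "\<delta> > 0" "2 * \<delta> < m" using m(1) by (auto simp: \<delta>_def)
  define R where "R = max (norm (f x)) (norm (f y))"
  obtain n where "2 * R / \<delta> \<le> real n" using real_arch_simple by blast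
  then have n: "2 * R \<le> real n * \<delta>" using \<delta>(1) by (simp add: pos_divide_le_eq)
  define g where "g p t = cell \<delta> (real (fst p) * \<delta> - R) (real (snd p) * \<delta> - R) (f t)" for p t
  define S where "S = {..<Suc n} \<times> {..<Suc n}"
  define I where "I = {p \<in> S. g p y = 0}"
  have "g p x = 0 \<or> g p y = 0" for p
    unfolding g_def using m(2) cell_eq_0_if_bounded_below[OF _ _ \<delta>] f(2,3) by blast
  then have "(\<Sum>p\<in>I. g p x) = (\<Sum>p\<in>S. g p x)"
    by (intro sum.mono_neutral_left) (auto simp: I_def S_def)
  also have "\<dots> = 1"
    using sum_cells[OF \<delta>(1) n, of "f x"]
    by (simp add: g_def S_def R_def case_prod_unfold del: sum.lessThan_Suc)
  finally have "(\<Sum>p\<in>I. g p x) = 1" .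
  moreover have "(\<Sum>p\<in>I. g p y) = 0" by (simp add: I_def)
  moreover have "(\<lambda>t. \<Sum>p\<in>I. g p t) \<in> right_multipliers E"
    unfolding g_def by (intro right_multipliers_sum right_multipliers_cell f)
  ultimately show ?thesis by (intro bexI[of _ "\<lambda>t. \<Sum>p\<in>I. g p t"]) simp_all
qed

section \<open>Degenerate points and separated sets\<close>

definition degenerate :: "'x set" where
  "degenerate = {x. \<forall>f\<in>E. \<not> invertible_el (f x)}"

lemma nondegenerate_unit:
  assumes "x \<notin> degenerate" shows "\<exists>h\<in>E. h x = 1"
proof -
  obtain f where f: "f \<in> E" "invertible_el (f x)" using assms by (auto simp: degenerate_def)
  define k where "k t = st (f t) * f t" for t
  have k: "k \<in> E" "\<And>t. st (k t) = k t"
    unfolding k_def by (intro mult_mem star_mem f) (simp add: st_mult)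
  have "invertible_el (k x)" unfolding k_def by (intro invertible_el_mult invertible_el_st f)
  then obtain m where m: "m > 0" "bounded_below m (k x)" using invertible_el_imp_bounded_below by blast
  have cont: "continuous_on UNIV (\<lambda>t. 1 - tent (m / 2) 0 t)"
    by (intro continuous_intros continuous_on_tent)
  have "cfc (\<lambda>t. tent (m / 2) 0 (poly [:0, 1:] t)) (k x) = 0"
    by (rule cfc_tent_eq_0_if_bounded_below[OF k(2)]) (use m in auto)
  then have "cfc (tent (m / 2) 0) (k x) = 0" by simp
  then have "cfc (\<lambda>t. 1 - tent (m / 2) 0 t) (k x) = 1"
    using cfc_add[OF k(2) cont continuous_on_tent[of "m / 2" 0], of x] by (simp add: cfc_const[OF k(2)])
  moreover have "(\<lambda>t. cfc (\<lambda>t. 1 - tent (m / 2) 0 t) (k t)) \<in> E"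
    by (rule cfc_mem[OF k cont]) (simp add: tent_def)
  ultimately show ?thesis by (intro bexI) auto
qed

lemma nondegenerate_iff: "x \<notin> degenerate \<longleftrightarrow> (\<exists>h\<in>E. h x = 1)"
proof
  assume "\<exists>h\<in>E. h x = 1"
  then obtain h where h: "h \<in> E" "h x = 1" by blast
  then have "invertible_el (h x)" by (intro invertible_elI[of _ 1]) simp_all
  then show "x \<notin> degenerate" using h(1) by (auto simp: degenerate_def)
qed (rule nondegenerate_unit)

lemma cutoff:
  assumes h: "h \<in> E"
  obtains g where "g \<in> E" "\<And>x. norm (h x - 1) \<le> 1/4 \<Longrightarrow> g x = 1"
    "\<And>x. norm (h x) \<le> 1/4 \<Longrightarrow> g x = 0" "\<And>x. norm (g x) \<le> 1"
proof
  define ramp where "ramp t = unit_clamp (2 * t - 1/2)" for t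
  have ramp: "continuous_on UNIV ramp"
    unfolding ramp_def unit_clamp_def by (intro continuous_intros)
  have ramp_1: "ramp t = 1" if "\<bar>t - 1\<bar> \<le> 1/4" for t
    unfolding ramp_def by (rule unit_clamp_eq_1) (use that in linarith)
  have ramp_0: "ramp t = 0" if "\<bar>t - 0\<bar> \<le> 1/4" for t
    unfolding ramp_def by (rule unit_clamp_eq_0) (use that in linarith)
  define g where "g x = cfc ramp (real_part (h x))" for x
  show "g \<in> E" unfolding g_def
    by (rule cfc_mem[OF real_part_mem[OF h] st_real_part ramp]) (simp add: ramp_0)
  show "g x = 1" if "norm (h x - 1) \<le> 1/4" for x
  proof -
    have "norm (real_part (h x) - 1 *\<^sub>R 1) \<le> 1/4"
      using norm_real_part_le[of "h x - 1"] that by (simp add: real_part_diff)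
    then have "g x = 1 *\<^sub>R 1" unfolding g_def
      by (rule cfc_eq_const[OF st_real_part _ ramp]) (rule ramp_1)
    then show ?thesis by simp
  qed
  show "g x = 0" if "norm (h x) \<le> 1/4" for x
  proof -
    have "norm (real_part (h x) - 0 *\<^sub>R 1) \<le> 1/4"
      using norm_real_part_le[of "h x"] that by simp
    then have "g x = 0 *\<^sub>R 1" unfolding g_def
      by (rule cfc_eq_const[OF st_real_part _ ramp]) (rule ramp_0)
    then show ?thesis by simp
  qed
  show "norm (g x) \<le> 1" for x unfolding g_def
    by (rule norm_cfc_le[OF st_real_part, of _ 0, OF _ ramp]) (auto simp: ramp_def unit_clamp_def)
qed

definition separated :: "'x set \<Rightarrow> 'x set \<Rightarrow> bool" where
  "separated U V \<longleftrightarrow> (\<exists>h\<in>E. (\<forall>x\<in>U. h x = 1) \<and> (\<forall>x\<in>V. h x = 0))"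

lemma separatedI:
  assumes "h \<in> E" "\<And>x. x \<in> U \<Longrightarrow> norm (h x - 1) \<le> 1/4" "\<And>x. x \<in> V \<Longrightarrow> norm (h x) \<le> 1/4"
  shows "separated U V"
  using cutoff[OF assms(1)] assms(2,3) unfolding separated_def by metis

lemma separatedE:
  assumes "separated U V"
  obtains h where "h \<in> E" "\<And>x. x \<in> U \<Longrightarrow> h x = 1" "\<And>x. x \<in> V \<Longrightarrow> h x = 0" "\<And>x. norm (h x) \<le> 1"
proof -
  obtain h where h: "h \<in> E" "\<forall>x\<in>U. h x = 1" "\<forall>x\<in>V. h x = 0" using assms by (auto simp: separated_def)
  obtain g where g: "g \<in> E" "\<And>x. norm (h x - 1) \<le> 1/4 \<Longrightarrow> g x = 1"
    "\<And>x. norm (h x) \<le> 1/4 \<Longrightarrow> g x = 0" "\<And>x. norm (g x) \<le> 1"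
    by (rule cutoff[OF h(1)]) blast
  show ?thesis by (rule that[OF g(1)]) (use g h in auto)
qed

lemma separated_mono: "separated U V \<Longrightarrow> U' \<subseteq> U \<Longrightarrow> V' \<subseteq> V \<Longrightarrow> separated U' V'"
  unfolding separated_def by blast

lemma separated_empty: "separated {} V"
  unfolding separated_def using zero_mem by force

lemma separated_Int_Un:
  assumes "separated U V" "separated U' V'" shows "separated (U \<inter> U') (V \<union> V')"
proof -
  obtain h k where "h \<in> E" "k \<in> E" "\<forall>x\<in>U. h x = 1" "\<forall>x\<in>V. h x = 0" "\<forall>x\<in>U'. k x = 1" "\<forall>x\<in>V'. k x = 0"
    using assms by (auto simp: separated_def)
  then show ?thesis unfolding separated_def by (intro bexI[of _ "\<lambda>x. h x * k x"] mult_mem) auto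
qed

lemma separated_Un:
  assumes "separated U V" "separated U' V" shows "separated (U \<union> U') V"
proof -
  obtain h k where "h \<in> E" "k \<in> E" "\<forall>x\<in>U. h x = 1" "\<forall>x\<in>V. h x = 0" "\<forall>x\<in>U'. k x = 1" "\<forall>x\<in>V. k x = 0"
    using assms by (auto simp: separated_def)
  then show ?thesis unfolding separated_def
    by (intro bexI[of _ "\<lambda>x. h x + k x - h x * k x"] add_mem diff_mem mult_mem) auto
qed

lemma separated_neighbourhoods:
  assumes "separated U V"
  obtains U' V' where "open U'" "open V'" "U \<subseteq> U'" "V \<subseteq> V'" "separated U' V'"
proof -
  obtain h where h: "h \<in> E" "\<And>x. x \<in> U \<Longrightarrow> h x = 1" "\<And>x. x \<in> V \<Longrightarrow> h x = 0"
    by (rule separatedE[OF assms]) blast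
  show ?thesis
  proof
    show "open {x. norm (h x - 1) < 1/4}" "open {x. norm (h x) < 1/4}"
      by (intro open_Collect_less continuous_intros continuous_on_mem[OF h(1)])+
    show "separated {x. norm (h x - 1) < 1/4} {x. norm (h x) < 1/4}"
      by (rule separatedI[OF h(1)]) auto
  qed (use h in auto)
qed

lemma separated_nondegenerate:
  assumes "x \<notin> degenerate"
  obtains U K where "open U" "x \<in> U" "compact K" "separated U (- K)"
proof -
  obtain h where h: "h \<in> E" "h x = 1" using nondegenerate_unit[OF assms] by blast
  show ?thesis
  proof
    show "open {t. norm (h t - 1) < 1/4}"
      by (intro open_Collect_less continuous_intros continuous_on_mem[OF h(1)])
    show "compact {t. 1/4 \<le> norm (h t)}" by (rule compact_C0_superlevel) (use subset_C0 h(1) in auto)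
    show "separated {t. norm (h t - 1) < 1/4} (- {t. 1/4 \<le> norm (h t)})"
      by (rule separatedI[OF h(1)]) auto
  qed (simp add: h)
qed

lemma closed_degenerate: "closed degenerate"
  unfolding closed_def
proof (subst open_subopen, intro ballI)
  fix x assume "x \<in> - degenerate"
  then obtain U K where U: "open U" "x \<in> U" "separated U (- K)"
    using separated_nondegenerate by blast
  then have "U \<subseteq> - degenerate" using nondegenerate_iff by (auto simp: separated_def)
  then show "\<exists>T. open T \<and> x \<in> T \<and> T \<subseteq> - degenerate" using U by blast
qed

end

locale separating_function_algebra = closed_function_algebra st E
  for st :: "'a::complex_banach_algebra_1 \<Rightarrow> 'a" and E :: "('x::topological_space \<Rightarrow> 'a) set" +
  assumes separation: "spectrally_separates st E x y \<or> norm_equiv E x y"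
begin

lemma norm_equiv_nondegenerate:
  assumes "norm_equiv E x y" "x \<notin> degenerate" shows "y \<notin> degenerate"
proof -
  obtain h where h: "h \<in> E" "h x = 1" using nondegenerate_unit[OF assms(2)] by blast
  have "norm (h y + (-1) *\<^sub>C 1) = norm (h x + (-1) *\<^sub>C 1)"
    using assms(1) h(1) by (simp add: norm_equiv_def)
  then have "h y = 1" by (simp add: h(2) scaleC_minus_one)
  then show ?thesis using h(1) nondegenerate_iff by blast
qed

lemma degenerate_norm_equiv:
  assumes "x \<in> degenerate" "y \<in> degenerate" shows "norm_equiv E x y"
proof -
  have "0 \<in> spec (f x) \<inter> spec (f y)" if "f \<in> E" for f
    using assms that by (simp add: degenerate_def spec_def scaleC.zero_left)
  then show ?thesis using separation[of x y] by (auto simp: spectrally_separates_def)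
qed

lemma separated_points:
  assumes x: "x \<notin> degenerate" and xy: "\<not> norm_equiv E x y" shows "separated {x} {y}"
proof -
  obtain f where "f \<in> E" "normal_el st (f x)" "normal_el st (f y)" "spec (f x) \<inter> spec (f y) = {}"
    using separation[of x y] xy by (auto simp: spectrally_separates_def)
  then obtain g where g: "g \<in> right_multipliers E" "g x = 1" "g y = 0"
    using right_multiplier_separates by blast
  obtain h where h: "h \<in> E" "h x = 1" using nondegenerate_unit[OF x] by blast
  have "(\<lambda>t. h t * g t) \<in> E" using g(1) h(1) by (simp add: right_multipliers_def)
  then show ?thesis unfolding separated_def using g h by (intro bexI[of _ "\<lambda>t. h t * g t"]) auto
qed

lemma separated_point_closed:
  assumes x: "x \<notin> degenerate" and V: "closed V" and xV: "\<forall>y\<in>V. \<not> norm_equiv E x y"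
  shows "\<exists>U. open U \<and> x \<in> U \<and> separated U V"
proof -
  obtain U0 K where U0: "open U0" "x \<in> U0" "compact K" "separated U0 (- K)"
    by (rule separated_nondegenerate[OF x])
  have "\<exists>U. open U \<and> x \<in> U \<and> separated U (- K \<union> (V \<inter> K))"
  proof (rule compact_induct[where K = "V \<inter> K"
        and P = "\<lambda>W. \<exists>U. open U \<and> x \<in> U \<and> separated U (- K \<union> W)"])
    show "compact (V \<inter> K)" using V U0(3) by (rule closed_Int_compact)
    show "\<exists>U. open U \<and> x \<in> U \<and> separated U (- K \<union> {})" using U0 by auto
    show "\<exists>U. open U \<and> x \<in> U \<and> separated U (- K \<union> A)"
      if "\<exists>U. open U \<and> x \<in> U \<and> separated U (- K \<union> B)" "A \<subseteq> B" for A B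
      using that separated_mono by (meson Un_mono order_refl)
    fix y assume "y \<in> V \<inter> K"
    then have "separated {x} {y}" using xV by (intro separated_points[OF x]) auto
    then obtain U W where UW: "open U" "open W" "{x} \<subseteq> U" "{y} \<subseteq> W" "separated U W"
      by (rule separated_neighbourhoods)
    have "\<exists>U. open U \<and> x \<in> U \<and> separated U (- K \<union> (A \<union> W))"
      if "open U'" "x \<in> U'" "separated U' (- K \<union> A)" for A U'
      using that UW separated_Int_Un[OF that(3) UW(5)]
        by (intro exI[of _ "U' \<inter> U"]) (auto simp: Un_assoc)
    then show "\<exists>W. open W \<and> y \<in> W \<and> (\<forall>A. (\<exists>U. open U \<and> x \<in> U \<and> separated U (- K \<union> A)) \<longrightarrow>
        (\<exists>U. open U \<and> x \<in> U \<and> separated U (- K \<union> (A \<union> W))))"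
      using UW by (intro exI[of _ W]) auto
  qed
  then show ?thesis using separated_mono[OF _ order_refl, of _ "- K \<union> (V \<inter> K)" V] by blast
qed

lemma separated_compact_closed:
  assumes "compact K" "K \<inter> degenerate = {}" "closed V"
    and "\<And>x y. x \<in> K \<Longrightarrow> y \<in> V \<Longrightarrow> \<not> norm_equiv E x y"
  shows "separated K V"
proof (rule compact_induct[OF assms(1), where P = "\<lambda>U. separated U V"])
  show "separated {} V" by (rule separated_empty)
  show "separated A V" if "separated B V" "A \<subseteq> B" for A B
    using that separated_mono by blast
  fix x assume "x \<in> K"
  then have "\<exists>U. open U \<and> x \<in> U \<and> separated U V"
    using assms(2-4) by (intro separated_point_closed) auto
  then obtain U where "open U" "x \<in> U" "separated U V" by blast
  then show "\<exists>U. open U \<and> x \<in> U \<and> (\<forall>A. separated A V \<longrightarrow> separated (A \<union> U) V)"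
    by (intro exI[of _ U]) (simp add: separated_Un)
qed

end

section \<open>Scalar functions and gluing\<close>

lemma sum_unit_clamp:
  assumes "0 \<le> t" "t \<le> real n"
  shows "(\<Sum>k<n. unit_clamp (t - real k)) = t"
  using assms
proof (induction n arbitrary: t)
  case (Suc n)
  show ?case
  proof (cases "t \<le> real n")
    case True
    then show ?thesis using Suc by (simp add: unit_clamp_eq_0)
  next
    case False
    have "(\<Sum>k<n. unit_clamp (t - real k)) = (\<Sum>k<n. 1)"
      using False by (intro sum.cong unit_clamp_eq_1) auto
    then show ?thesis using False Suc.prems by (simp add: unit_clamp_def)
  qed
qed simp

lemma norm_layer_average_diff_le:
  fixes h :: "nat \<Rightarrow> 'a::real_normed_algebra_1"
  assumes "n > 0" and t: "0 \<le> t" "t \<le> real n"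
    and one: "\<And>k. real (Suc k) \<le> t \<Longrightarrow> h k = 1" and zero: "\<And>k. t \<le> real k \<Longrightarrow> h k = 0"
    and bound: "\<And>k. norm (h k) \<le> 1"
  shows "norm ((1 / real n) *\<^sub>R (\<Sum>k<n. h k) - (t / real n) *\<^sub>R 1) \<le> 2 / real n"
proof -
  have "(t / real n) *\<^sub>R (1::'a) = (1 / real n) *\<^sub>R (\<Sum>k<n. unit_clamp (t - real k) *\<^sub>R 1)"
    by (simp add: sum_unit_clamp[OF t] flip: scaleR_sum_left)
  then have "norm ((1 / real n) *\<^sub>R (\<Sum>k<n. h k) - (t / real n) *\<^sub>R 1)
      = (1 / real n) * norm (\<Sum>k<n. h k - unit_clamp (t - real k) *\<^sub>R 1)"
    by (simp add: sum_subtractf flip: scaleR_diff_right)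
  also have "\<dots> \<le> (1 / real n) * (\<Sum>k<n. if k = nat \<lfloor>t\<rfloor> then 2 else 0)"
  proof (intro mult_left_mono sum_norm_le)
    fix k
    consider "t \<le> real k" | "real (Suc k) \<le> t" | "real k < t" "t < real k + 1" by linarith
    then show "norm (h k - unit_clamp (t - real k) *\<^sub>R 1) \<le> (if k = nat \<lfloor>t\<rfloor> then 2 else 0)"
    proof cases
      case 3
      then have "\<lfloor>t\<rfloor> = int k" by (simp add: floor_eq_iff)
      have "norm (h k - unit_clamp (t - real k) *\<^sub>R 1)
          \<le> norm (h k) + norm (unit_clamp (t - real k) *\<^sub>R (1::'a))"
        by (rule norm_triangle_ineq4)
      also have "\<dots> \<le> 1 + 1" using bound by (intro add_mono) (auto simp: unit_clamp_def)
      finally show ?thesis using \<open>\<lfloor>t\<rfloor> = int k\<close> by simp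
    qed (simp_all add: one zero unit_clamp_eq_0 unit_clamp_eq_1)
  qed simp
  also have "\<dots> \<le> (1 / real n) * 2" by (intro mult_left_mono) auto
  finally show ?thesis by simp
qed

context separating_function_algebra
begin

lemma separated_superlevel_sublevel:
  fixes \<theta> :: "'x \<Rightarrow> real"
  assumes \<theta>: "\<theta> \<in> C0" "\<And>x. 0 \<le> \<theta> x"
    and equiv: "\<And>x y. norm_equiv E x y \<Longrightarrow> \<theta> x = \<theta> y"
    and degenerate: "\<And>x. x \<in> degenerate \<Longrightarrow> \<theta> x = 0"
    and levels: "0 < t" "s < t"
  shows "separated {x. t \<le> \<theta> x} {x. \<theta> x \<le> s}"
proof (rule separated_compact_closed)
  show "compact {x. t \<le> \<theta> x}" using compact_C0_superlevel[OF \<theta>(1) levels(1)] \<theta>(2) by simp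
  show "{x. t \<le> \<theta> x} \<inter> degenerate = {}" using degenerate levels(1) by force
  show "closed {x. \<theta> x \<le> s}" by (intro closed_Collect_le continuous_intros C0_continuous \<theta>)
  show "\<not> norm_equiv E x y" if "x \<in> {x. t \<le> \<theta> x}" "y \<in> {x. \<theta> x \<le> s}" for x y
    using that equiv[of x y] levels(2) by auto
qed

text \<open>The average of \<open>n\<close> functions, of which the \<open>k\<close>-th is \<open>1\<close> where \<open>\<theta> \<ge> (k + 1) / n\<close> and \<open>0\<close> where
  \<open>\<theta> \<le> k / n\<close>, is close to \<open>\<theta>\<close>: at every point at most one summand is not scalar.\<close>

lemma scalar_function_mem:
  fixes \<theta> :: "'x \<Rightarrow> real"
  assumes \<theta>: "\<theta> \<in> C0" "\<And>x. 0 \<le> \<theta> x" "\<And>x. \<theta> x \<le> 1"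
    and equiv: "\<And>x y. norm_equiv E x y \<Longrightarrow> \<theta> x = \<theta> y"
    and degenerate: "\<And>x. x \<in> degenerate \<Longrightarrow> \<theta> x = 0"
  shows "(\<lambda>x. \<theta> x *\<^sub>R 1) \<in> E"
proof (rule uniform_limit_mem)
  fix e :: real assume "e > 0"
  obtain n where "2 / e < real n" using reals_Archimedean2 by blast
  moreover have "0 < 2 / e" using \<open>e > 0\<close> by simp
  ultimately have "0 < real n" by linarith
  then have n: "n > 0" "2 / real n \<le> e"
    using \<open>2 / e < real n\<close> \<open>e > 0\<close> by (auto simp: field_simps)
  have "separated {x. real (Suc k) / n \<le> \<theta> x} {x. \<theta> x \<le> real k / n}" for k
    using n(1) by (intro separated_superlevel_sublevel[OF \<theta>(1,2) equiv degenerate])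
      (auto simp: divide_strict_right_mono)
  then have "\<exists>h\<in>E. (\<forall>x. real (Suc k) / n \<le> \<theta> x \<longrightarrow> h x = 1) \<and> (\<forall>x. \<theta> x \<le> real k / n \<longrightarrow> h x = 0) \<and>
      (\<forall>x. norm (h x) \<le> 1)" for k
    by (rule separatedE) auto
  then obtain h where h: "\<And>k. h k \<in> E" "\<And>k x. real (Suc k) / n \<le> \<theta> x \<Longrightarrow> h k x = 1"
    "\<And>k x. \<theta> x \<le> real k / n \<Longrightarrow> h k x = 0" "\<And>k x. norm (h k x) \<le> 1"
    by metis
  have "norm ((1 / real n) *\<^sub>R (\<Sum>k<n. h k x) - \<theta> x *\<^sub>R 1) \<le> e" for x
  proof -
    have "norm ((1 / real n) *\<^sub>R (\<Sum>k<n. h k x) - (real n * \<theta> x / real n) *\<^sub>R 1) \<le> 2 / real n"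
    proof (rule norm_layer_average_diff_le)
      show "0 \<le> real n * \<theta> x" "real n * \<theta> x \<le> real n" using \<theta>(2,3) by (simp_all add: mult_left_le)
      show "h k x = 1" if "real (Suc k) \<le> real n * \<theta> x" for k
        using that n(1) by (intro h(2)) (simp add: field_simps)
      show "h k x = 0" if "real n * \<theta> x \<le> real k" for k
        using that n(1) by (intro h(3)) (simp add: field_simps)
    qed (use n(1) h(4) in auto)
    then show ?thesis using n by simp
  qed
  moreover have "(\<lambda>x. (1 / real n) *\<^sub>R (\<Sum>k<n. h k x)) \<in> E"
    by (intro scaleR_mem sum_mem h)
  ultimately show "\<exists>v\<in>E. \<forall>x. norm (v x - \<theta> x *\<^sub>R 1) \<le> e"
    by (intro bexI[of _ "\<lambda>x. (1 / real n) *\<^sub>R (\<Sum>k<n. h k x)"]) simp_all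
qed

lemma scalar_bump_function:
  assumes "x \<notin> degenerate" "closed V" "degenerate \<subseteq> V" "\<forall>y\<in>V. \<not> norm_equiv E x y"
  obtains U \<theta> where "open U" "x \<in> U" "(\<lambda>t. \<theta> t *\<^sub>R 1) \<in> E" "\<forall>t. 0 \<le> \<theta> t \<and> \<theta> t \<le> 1"
    "\<forall>t\<in>U. \<theta> t = 1" "\<forall>t\<in>V. \<theta> t = 0"
proof -
  obtain U where U: "open U" "x \<in> U" "separated U V"
    using separated_point_closed[OF assms(1,2,4)] by blast
  obtain h where h: "h \<in> E" "\<And>t. t \<in> U \<Longrightarrow> h t = 1" "\<And>t. t \<in> V \<Longrightarrow> h t = 0" "\<And>t. norm (h t) \<le> 1"
    by (rule separatedE[OF U(3)]) blast
  have "(\<lambda>t. norm (h t) *\<^sub>R 1) \<in> E"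
  proof (rule scalar_function_mem)
    show "(\<lambda>t. norm (h t)) \<in> C0" using subset_C0 h(1) by (auto intro: C0_norm)
  qed (use h assms(3) norm_equivD in auto)
  then show ?thesis using U h by (intro that[of U "\<lambda>t. norm (h t)"]) auto
qed

lemma Delta2_norm_diff_equiv:
  assumes u: "u \<in> Delta2 E" and v: "v \<in> E" and xy: "norm_equiv E x y"
  shows "norm (v x - u x) = norm (v y - u y)"
proof -
  have "norm (v x - u x) \<le> norm (v y - u y)" if xy: "norm_equiv E x y" for x y
  proof (rule field_le_epsilon)
    fix e :: real assume "e > 0"
    then obtain w where w: "w \<in> E" "norm (w x - u x) < e/2" "norm (w y - u y) < e/2"
      using u half_gt_zero unfolding Delta2_def by blast
    have "norm (v x - w x) = norm (v y - w y)" by (rule norm_equivD[OF xy diff_mem[OF v w(1)]])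
    moreover have "norm (v x - u x) \<le> norm (v x - w x) + norm (w x - u x)"
      using norm_triangle_ineq[of "v x - w x" "w x - u x"] by simp
    moreover have "norm (v y - w y) \<le> norm (v y - u y) + norm (w y - u y)"
      using norm_triangle_ineq4[of "v y - u y" "w y - u y"] by simp
    ultimately show "norm (v x - u x) \<le> norm (v y - u y) + e" using w by linarith
  qed
  from this[OF xy] this[OF norm_equiv_sym[OF xy]] show ?thesis by simp
qed

text \<open>Since scalars are central, the error of the interpolant is a convex combination of both errors.\<close>

lemma interpolate:
  assumes "v \<in> E" "w \<in> E" and \<theta>: "(\<lambda>t. \<theta> t *\<^sub>R 1) \<in> E" "\<forall>t. 0 \<le> \<theta> t \<and> \<theta> t \<le> 1"
  shows "\<exists>w'\<in>E. \<forall>t. norm (w' t - u t) \<le> (1 - \<theta> t) * norm (w t - u t) + \<theta> t * norm (v t - u t)"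
proof (intro bexI allI)
  fix t
  have "w t + \<theta> t *\<^sub>R 1 * (v t - w t) - u t = (1 - \<theta> t) *\<^sub>R (w t - u t) + \<theta> t *\<^sub>R (v t - u t)"
    by (simp add: algebra_simps)
  then show "norm (w t + \<theta> t *\<^sub>R 1 * (v t - w t) - u t)
      \<le> (1 - \<theta> t) * norm (w t - u t) + \<theta> t * norm (v t - u t)"
    using norm_triangle_ineq[of "(1 - \<theta> t) *\<^sub>R (w t - u t)" "\<theta> t *\<^sub>R (v t - u t)"] \<theta>(2) by simp
next
  show "(\<lambda>t. w t + \<theta> t *\<^sub>R 1 * (v t - w t)) \<in> E" by (intro add_mem mult_mem diff_mem assms)
qed

lemma Delta2_local_improvement:
  assumes u: "u \<in> Delta2 E" and x: "x \<notin> degenerate" and e: "e > 0"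
  obtains U where "open U" "x \<in> U"
    "\<forall>w\<in>E. \<exists>w'\<in>E. (\<forall>t\<in>U. norm (w' t - u t) \<le> e) \<and> (\<forall>t. norm (w' t - u t) \<le> max e (norm (w t - u t)))"
proof -
  obtain v where v: "v \<in> E" "norm (v x - u x) < e" using u e unfolding Delta2_def by blast
  define V where "V = degenerate \<union> {t. e \<le> norm (v t - u t)}"
  have "continuous_on UNIV u" using u by (auto simp: Delta2_def intro: C0_continuous)
  then have "closed V" unfolding V_def
    by (intro closed_Un closed_degenerate closed_Collect_le continuous_intros continuous_on_mem[OF v(1)])
  moreover have "degenerate \<subseteq> V" by (simp add: V_def)
  moreover have "\<forall>y\<in>V. \<not> norm_equiv E x y"
    using norm_equiv_nondegenerate[OF _ x] Delta2_norm_diff_equiv[OF u v(1)] v(2) by (auto simp: V_def)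
  ultimately obtain U \<theta> where U: "open U" "x \<in> U" and \<theta>: "(\<lambda>t. \<theta> t *\<^sub>R 1) \<in> E"
    "\<forall>t. 0 \<le> \<theta> t \<and> \<theta> t \<le> 1" "\<forall>t\<in>U. \<theta> t = 1" "\<forall>t\<in>V. \<theta> t = 0"
    by (rule scalar_bump_function[OF x])
  have "\<exists>w'\<in>E. (\<forall>t\<in>U. norm (w' t - u t) \<le> e) \<and> (\<forall>t. norm (w' t - u t) \<le> max e (norm (w t - u t)))"
    if w: "w \<in> E" for w
  proof -
    obtain w' where w': "w' \<in> E"
      "\<forall>t. norm (w' t - u t) \<le> (1 - \<theta> t) * norm (w t - u t) + \<theta> t * norm (v t - u t)"
      using interpolate[OF v(1) w \<theta>(1,2)] by blast
    have error: "norm (w' t - u t) \<le> (1 - \<theta> t) * norm (w t - u t) + \<theta> t * e" for t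
    proof -
      have "\<theta> t * norm (v t - u t) \<le> \<theta> t * e"
        using \<theta>(2,4) by (cases "t \<in> V") (auto simp: V_def intro: mult_left_mono)
      then show ?thesis using w'(2)[rule_format, of t] by linarith
    qed
    have "norm (w' t - u t) \<le> max e (norm (w t - u t))" for t
      using error[of t] \<theta>(2)
        convex_bound_le[of "norm (w t - u t)" "max e (norm (w t - u t))" e "1 - \<theta> t" "\<theta> t"]
      by simp
    moreover have "norm (w' t - u t) \<le> e" if "t \<in> U" for t
      using error[of t] \<theta>(3) that by simp
    ultimately show ?thesis using w'(1) by blast
  qed
  then show ?thesis using that U by blast
qed

lemma Delta2_approx:
  assumes u: "u \<in> Delta2 E" and w0: "w0 \<in> E" and e: "e > 0"
    and degenerate: "\<And>x. x \<in> degenerate \<Longrightarrow> norm (w0 x - u x) < e"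
  shows "\<exists>w\<in>E. \<forall>x. norm (w x - u x) \<le> e"
proof -
  define far where "far = {x. e \<le> norm (w0 x - u x)}"
  define approximable where "approximable A \<longleftrightarrow>
    (\<exists>w\<in>E. (\<forall>x\<in>A. norm (w x - u x) \<le> e) \<and> (\<forall>x. norm (w x - u x) \<le> max e (norm (w0 x - u x))))" for A
  have "approximable far"
  proof (rule compact_induct)
    have "(\<lambda>x. w0 x - u x) \<in> C0" using w0 u subset_C0 by (intro C0_diff) (auto simp: Delta2_def)
    then show "compact far" unfolding far_def using e by (rule compact_C0_superlevel)
    show "approximable {}" unfolding approximable_def using w0 by (intro bexI[of _ w0]) auto
    show "approximable A" if "approximable B" "A \<subseteq> B" for A B
      using that unfolding approximable_def by blast
    fix x assume "x \<in> far"
    then have "x \<notin> degenerate" using degenerate by (force simp: far_def)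
    then obtain U where U: "open U" "x \<in> U"
      "\<forall>w\<in>E. \<exists>w'\<in>E. (\<forall>t\<in>U. norm (w' t - u t) \<le> e) \<and> (\<forall>t. norm (w' t - u t) \<le> max e (norm (w t - u t)))"
      by (rule Delta2_local_improvement[OF u _ e])
    have "approximable (A \<union> U)" if "approximable A" for A
    proof -
      obtain w where w: "w \<in> E" "\<forall>x\<in>A. norm (w x - u x) \<le> e"
        "\<forall>x. norm (w x - u x) \<le> max e (norm (w0 x - u x))"
        using \<open>approximable A\<close> by (auto simp: approximable_def)
      obtain w' where w': "w' \<in> E" "\<forall>t\<in>U. norm (w' t - u t) \<le> e"
        "\<forall>t. norm (w' t - u t) \<le> max e (norm (w t - u t))"
        using U(3) w(1) by blast
      have "norm (w' t - u t) \<le> e" if "t \<in> A" for t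
        using that w(2) w'(3)[rule_format, of t] by auto
      moreover have "norm (w' t - u t) \<le> max e (norm (w0 t - u t))" for t
        using w(3)[rule_format, of t] w'(3)[rule_format, of t] by linarith
      ultimately show ?thesis unfolding approximable_def using w'(1,2) by blast
    qed
    then show "\<exists>U. open U \<and> x \<in> U \<and> (\<forall>A. approximable A \<longrightarrow> approximable (A \<union> U))" using U(1,2) by blast
  qed
  then obtain w where w: "w \<in> E" "\<forall>x\<in>far. norm (w x - u x) \<le> e"
    "\<forall>x. norm (w x - u x) \<le> max e (norm (w0 x - u x))"
    by (auto simp: approximable_def)
  have "norm (w x - u x) \<le> e" for x
    using w(2,3) by (cases "x \<in> far") (auto simp: far_def max_def split: if_splits)
  then show ?thesis using w(1) by blast
qed

lemma Delta2_subset: "Delta2 E \<subseteq> E"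
proof
  fix u assume u: "u \<in> Delta2 E"
  show "u \<in> E"
  proof (rule uniform_limit_mem)
    fix e :: real assume e: "e > 0"
    have "\<exists>w\<in>E. \<forall>x\<in>degenerate. norm (w x - u x) < e"
    proof (cases "degenerate = {}")
      case False
      then obtain z where z: "z \<in> degenerate" by blast
      obtain w where w: "w \<in> E" "norm (w z - u z) < e" using u e unfolding Delta2_def by blast
      then have "norm (w x - u x) < e" if "x \<in> degenerate" for x
        using Delta2_norm_diff_equiv[OF u w(1) degenerate_norm_equiv[OF z that]] by simp
      then show ?thesis using w(1) by blast
    qed (use zero_mem in auto)
    then show "\<exists>w\<in>E. \<forall>x. norm (w x - u x) \<le> e" using Delta2_approx[OF u _ e] by blast
  qed
qed

end

theorem theorem2p2:
  fixes st :: "'a::complex_banach_algebra_1 \<Rightarrow> 'a"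
    and E :: "('x::t2_space \<Rightarrow> 'a) set"
  assumes "locally_compact_space (euclidean :: 'x topology)"
    and "cstar_involution st"
    and "star_subalgebra st E"
    and AX0: "\<not> compact (UNIV :: 'x set) \<Longrightarrow>
              \<forall>z. (\<exists>f0\<in>E. invertible_el (f0 z)) \<or> (\<forall>f\<in>E. f z = 0)"
    and AX12: "\<forall>x y. spectrally_separates st E x y \<or>
              (\<forall>f\<in>E. (\<forall>t. st (f t) = f t) \<longrightarrow> Mspec (f x) = Mspec (f y))"
  shows "uniform_closure E = Delta2 E"
proof
  interpret cstar_algebra st by unfold_locales fact
  have E: "E \<subseteq> C0" "E \<subseteq> uniform_closure E"
    using star_subalgebra_subset_C0[OF assms(3)] subset_uniform_closure by blast+
  show "uniform_closure E \<subseteq> Delta2 E" by (rule uniform_closure_subset_Delta2[OF E(1)])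
  interpret separating_function_algebra st "uniform_closure E"
  proof unfold_locales
    show "star_subalgebra st (uniform_closure E)" by (rule star_subalgebra_uniform_closure) fact
    show "uniform_closure (uniform_closure E) \<subseteq> uniform_closure E"
      by (rule uniform_closure_idem_subset[OF E(1)])
    show "spectrally_separates st (uniform_closure E) x y \<or> norm_equiv (uniform_closure E) x y" for x y
    proof (cases "spectrally_separates st E x y")
      case True
      then show ?thesis using E(2) unfolding spectrally_separates_def by blast
    next
      case False
      then have "norm_equiv E x y" using AX12 by (intro Mspec_eq_imp_norm_equiv[OF assms(3)]) blast
      then show ?thesis using norm_equiv_uniform_closure[OF E(1)] by blast
    qed
  qed
  have "Delta2 E \<subseteq> Delta2 (uniform_closure E)" by (rule Delta2_mono[OF E(2)])
  also have "\<dots> \<subseteq> uniform_closure E" by (rule Delta2_subset)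
  finally show "Delta2 E \<subseteq> uniform_closure E" .
qed

end
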